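(* Let $q<-1$ be an integer with $-q$ a prime power, let $D\ge3$, let $\Gamma=(X,\mathcal{R})$ be the dual polar graph ${}^2A_{2D-1}(-q)$, and fix $x\in X$. Then $$-\frac{q^4}{q^2+1}RL^2+LRL-\frac{q^{-2}}{q^2+1}L^2R=(-q)^{2D-1}L$$ holds on $E_i^*V$ for every $1\le i\le D$. In particular, $\Gamma$ supports a strongly uniform structure with respect to $x$, with $e_i^-=-q^4/(q^2+1)$ ($2\le i\le D$), $e_i^+=-q^{-2}/(q^2+1)$ ($1\le i\le D-1$), and $f_i=(-q)^{2D-1}$ ($1\le i\le D$).
   Context: For a prime power $r$, the dual polar graph ${}^2A_{2D-1}(r)$ has as vertices the maximal ($D$-dimensional) totally isotropic subspaces of a $2D$-dimensional space over $\mathrm{GF}(r^2)$ with a nondegenerate Hermitian form, adjacent iff their intersection has dimension $D-1$; it is non-bipartite, distance-regular of diameter $D$. Let $\partial$ be the distance, $V=\mathbb{C}^X$, $A$ the adjacency matrix, $E_i^*$ the diagonal $0/1$ matrix with $(y,y)$-entry $1$ iff $\partial(x,y)=i$; $L=\sum_{i=1}^{D}E^*_{i-1}AE^*_i$, $R=\sum_{i=0}^{D-1}E^*_{i+1}AE^*_i=L^\top$. $\Gamma_f$ is the graph on $X$ whose edges are the edges $yz$ of $\Gamma$ with $\partial(x,y)\ne\partial(x,z)$ (bipartite with lowering/raising matrices $L,R$). A parameter matrix is a tridiagonal complex $U=(e_{ij})_{1\le i,j\le D}$ with $e_{ii}=1$, with $e_{i,i-1}\ne0$ for all $2\le i\le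 D$ or $e_{i-1,i}\ne0$ for all $2\le i\le D$, and every principal submatrix $(e_{ij})_{s\le i,j\le t}$ nonsingular; $e_i^-=e_{i,i-1}$, $e_i^+=e_{i,i+1}$, $e_1^-=e_D^+=0$. A uniform structure of the bipartite graph $\Gamma_f$ w.r.t. $x$ is a pair $(U,f)$, $f\in\mathbb{C}^D$, with $e_i^-RL^2+LRL+e_i^+L^2R=f_iL$ on $E_i^*V$ for all $1\le i\le D$; strongly uniform if all $e_i^-$ ($2\le i\le D$) and $e_i^+$ ($1\le i\le D-1$) are nonzero. $\Gamma$ supports a strongly uniform structure w.r.t. $x$ if $\Gamma_f$ admits one. *)

theory Defs
  imports
    Complex_Main
    "HOL-Library.Extended_Nat"
    "HOL-Number_Theory.Prime_Powers"
    "Jordan_Normal_Form.Determinant"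
begin

section \<open>Hermitian spaces and the dual polar graph\<close>

text \<open>
  A nondegenerate Hermitian form on a \<open>2D\<close>-dimensional space over \<open>GF(r\<^sup>2)\<close>; the involutory
  automorphism of \<open>GF(r\<^sup>2)\<close> is \<open>a \<mapsto> a ^ r\<close>.  Semilinearity in the second argument follows from
  linearity in the first and the Hermitian symmetry.  For \<open>D > 0\<close> the condition on
  \<open>dim UNIV\<close> entails finite dimension, since \<open>dim\<close> is \<open>0\<close> on infinite-dimensional spaces.
\<close>

locale hermitian_space = Vector_Spaces.vector_space scale
  for scale :: "'k::{field,finite} \<Rightarrow> 'v::ab_group_add \<Rightarrow> 'v" +
  fixes r :: nat and D :: nat and h :: "'v \<Rightarrow> 'v \<Rightarrow> 'k"
  assumes card_field: "card (UNIV :: 'k set) = r ^ 2"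
    and dim_space: "dim UNIV = 2 * D"
    and form_add: "h (u + v) w = h u w + h v w"
    and form_scale: "h (scale a u) w = a * h u w"
    and form_hermitian: "h w u = h u w ^ r"
    and form_nondegenerate: "(\<And>w. h u w = 0) \<Longrightarrow> u = 0"
begin

definition totally_isotropic :: "'v set \<Rightarrow> bool" where
  "totally_isotropic U \<longleftrightarrow> subspace U \<and> (\<forall>u\<in>U. \<forall>w\<in>U. h u w = 0)"

text \<open>
  The maximal totally isotropic subspaces all have dimension \<open>D\<close>; both properties are recorded.
\<close>

definition dual_polar_vertices :: "'v set set" where
  "dual_polar_vertices =
     {U. totally_isotropic U \<and> dim U = D \<and>
         (\<forall>W. totally_isotropic W \<and> U \<subseteq> W \<longrightarrow> W = U)}"

definition dual_polar_edges :: "('v set \<times> 'v set) set" where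
  "dual_polar_edges =
     {(U, W). U \<in> dual_polar_vertices \<and> W \<in> dual_polar_vertices \<and> dim (U \<inter> W) = D - 1}"

end


section \<open>Distance and matrices indexed by a vertex set\<close>

text \<open>
  A graph is a vertex set \<open>X\<close> with a symmetric irreflexive relation \<open>E \<subseteq> X \<times> X\<close>.
\<close>

definition gdist :: "('x \<times> 'x) set \<Rightarrow> 'x \<Rightarrow> 'x \<Rightarrow> enat" where
  "gdist E y z = Inf {enat n |n. (y, z) \<in> E ^^ n}"

text \<open>
  Since \<open>X\<close> is a set and not a type, vectors and matrices over \<open>X\<close> are functions on the ambient
  type, and products sum over \<open>X\<close>.  The vectors and matrices below vanish outside \<open>X\<close>.
\<close>

type_synonym 'x cvec = "'x \<Rightarrow> complex"
type_synonym 'x cmat = "'x \<Rightarrow> 'x \<Rightarrow> complex"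

definition vecs :: "'x set \<Rightarrow> 'x cvec set" where
  "vecs X = {v. \<forall>y. y \<notin> X \<longrightarrow> v y = 0}"

definition mmul :: "'x set \<Rightarrow> 'x cmat \<Rightarrow> 'x cmat \<Rightarrow> 'x cmat" where
  "mmul X M N = (\<lambda>y z. \<Sum>w\<in>X. M y w * N w z)"

definition mapply :: "'x set \<Rightarrow> 'x cmat \<Rightarrow> 'x cvec \<Rightarrow> 'x cvec" where
  "mapply X M v = (\<lambda>y. \<Sum>z\<in>X. M y z * v z)"

definition agree_on :: "'x set \<Rightarrow> 'x cvec set \<Rightarrow> 'x cmat \<Rightarrow> 'x cmat \<Rightarrow> bool" where
  "agree_on X W M N \<longleftrightarrow> (\<forall>v\<in>W. mapply X M v = mapply X N v)"

definition adj_mat :: "('x \<times> 'x) set \<Rightarrow> 'x cmat" where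
  "adj_mat E = (\<lambda>y z. if (y, z) \<in> E then 1 else 0)"

definition dual_idem :: "'x set \<Rightarrow> ('x \<times> 'x) set \<Rightarrow> 'x \<Rightarrow> nat \<Rightarrow> 'x cmat" where
  "dual_idem X E x i = (\<lambda>y z. if y = z \<and> y \<in> X \<and> gdist E x y = enat i then 1 else 0)"

definition subconstituent :: "'x set \<Rightarrow> ('x \<times> 'x) set \<Rightarrow> 'x \<Rightarrow> nat \<Rightarrow> 'x cvec set" where
  "subconstituent X E x i = mapply X (dual_idem X E x i) ` vecs X"

definition lowering :: "nat \<Rightarrow> 'x set \<Rightarrow> ('x \<times> 'x) set \<Rightarrow> 'x \<Rightarrow> 'x cmat" where
  "lowering D X E x = (\<lambda>y z. \<Sum>i=1..D.
     mmul X (dual_idem X E x (i - 1)) (mmul X (adj_mat E) (dual_idem X E x i)) y z)"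

definition raising :: "nat \<Rightarrow> 'x set \<Rightarrow> ('x \<times> 'x) set \<Rightarrow> 'x \<Rightarrow> 'x cmat" where
  "raising D X E x = (\<lambda>y z. \<Sum>i<D.
     mmul X (dual_idem X E x (i + 1)) (mmul X (adj_mat E) (dual_idem X E x i)) y z)"

text \<open>The edges of \<open>\<Gamma>\<^sub>f\<close>: those not contained in a level set of the distance from \<open>x\<close>.\<close>

definition flat_edges_removed :: "('x \<times> 'x) set \<Rightarrow> 'x \<Rightarrow> ('x \<times> 'x) set" where
  "flat_edges_removed E x = {(y, z) \<in> E. gdist E x y \<noteq> gdist E x z}"


section \<open>Uniform structures\<close>

text \<open>
  Parameter matrices are indexed by \<open>1, \<dots>, D\<close>; entries outside that range are irrelevant.
\<close>

definition parameter_matrix :: "nat \<Rightarrow> (nat \<Rightarrow> nat \<Rightarrow> complex) \<Rightarrow> bool" where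
  "parameter_matrix D U \<longleftrightarrow>
     (\<forall>i\<in>{1..D}. \<forall>j\<in>{1..D}. i + 1 < j \<or> j + 1 < i \<longrightarrow> U i j = 0) \<and>
     (\<forall>i\<in>{1..D}. U i i = 1) \<and>
     ((\<forall>i\<in>{2..D}. U i (i - 1) \<noteq> 0) \<or> (\<forall>i\<in>{2..D}. U (i - 1) i \<noteq> 0)) \<and>
     (\<forall>s t. 1 \<le> s \<and> s \<le> t \<and> t \<le> D \<longrightarrow>
        det (mat (t - s + 1) (t - s + 1) (\<lambda>(i, j). U (s + i) (s + j))) \<noteq> 0)"

definition e_minus :: "(nat \<Rightarrow> nat \<Rightarrow> complex) \<Rightarrow> nat \<Rightarrow> complex" where
  "e_minus U i = (if i = 1 then 0 else U i (i - 1))"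

definition e_plus :: "nat \<Rightarrow> (nat \<Rightarrow> nat \<Rightarrow> complex) \<Rightarrow> nat \<Rightarrow> complex" where
  "e_plus D U i = (if i = D then 0 else U i (i + 1))"

text \<open>
  Uniform structures of a bipartite graph \<open>(X, E)\<close> with respect to \<open>x\<close>, where \<open>D\<close> is the
  largest distance from \<open>x\<close>.
\<close>

definition uniform_structure ::
  "nat \<Rightarrow> 'x set \<Rightarrow> ('x \<times> 'x) set \<Rightarrow> 'x \<Rightarrow> (nat \<Rightarrow> nat \<Rightarrow> complex) \<Rightarrow> (nat \<Rightarrow> complex) \<Rightarrow> bool" where
  "uniform_structure D X E x U f \<longleftrightarrow>
     parameter_matrix D U \<and>
     (let L = lowering D X E x; R = raising D X E x in
      \<forall>i\<in>{1..D}. agree_on X (subconstituent X E x i)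
        (\<lambda>y z. e_minus U i * mmul X R (mmul X L L) y z
               + mmul X L (mmul X R L) y z
               + e_plus D U i * mmul X L (mmul X L R) y z)
        (\<lambda>y z. f i * L y z))"

definition strongly_uniform_structure ::
  "nat \<Rightarrow> 'x set \<Rightarrow> ('x \<times> 'x) set \<Rightarrow> 'x \<Rightarrow> (nat \<Rightarrow> nat \<Rightarrow> complex) \<Rightarrow> (nat \<Rightarrow> complex) \<Rightarrow> bool" where
  "strongly_uniform_structure D X E x U f \<longleftrightarrow>
     uniform_structure D X E x U f \<and>
     (\<forall>i\<in>{2..D}. e_minus U i \<noteq> 0) \<and> (\<forall>i\<in>{1..D - 1}. e_plus D U i \<noteq> 0)"

definition supports_strongly_uniform :: "nat \<Rightarrow> 'x set \<Rightarrow> ('x \<times> 'x) set \<Rightarrow> 'x \<Rightarrow> bool" where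
  "supports_strongly_uniform D X E x \<longleftrightarrow>
     (\<exists>U f. strongly_uniform_structure D X (flat_edges_removed E x) x U f)"

end

(*
  Order the vertices by y <= z iff y lies on a geodesic from x to z.  The elements below z correspond
  to the subspaces of x containing x \<inter> z, and L, R are the covering matrices of this order, so
  the identity compares the numbers of paths from z to y with steps (down, down, up),
  (down, up, down) and (up, down, down).  Put b = q^2, let y lie one level below z, and let alpha
  be the number of vertices covered by y that lie below z.  Two vertices on one level with distinct
  intersections with x have b common upper covers for each common lower cover.  If y is not below z,
  then z has an upper cover above y (and then b^2 of them) only if alpha is not 0 and x \<inter> z is
  not contained in y.  So all three numbers are expressed by alpha, up to the paths through y <= z,
  which involve all upper covers of y or of z and produce the right-hand side.  The parameter matrix
  is Toeplitz, and its kernel recurrence has the solution b^k (1 + b + ... + b^k), which never vanishes.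
*)
theory Submission imports Defs begin

text \<open>Where the coefficients come from: let \<open>y\<close> be one level below
  \<open>z\<close> but not below \<open>z\<close> in the order. The counts for (down, down, up),
  (down, up, down) and (up, down, down) are (b+1) alpha, b^2 alpha, 0 if x \<inter> z is contained
  in \<open>y\<close>, and (b+1) alpha, b(b+1) alpha, b^2 (b+1) alpha otherwise. A combination of
  the three with middle coefficient 1 vanishes in both cases only for the outer coefficients
  -b^2/(b+1) and -1/(b(b+1)). The case where \<open>z\<close> covers \<open>y\<close> then fixes the
  right-hand side: b times the number of upper covers of \<open>y\<close> exceeds that of
  \<open>z\<close> by r b^D, which is b r^(2D-1). The obstacle is the asymmetry of the order. Below
  a vertex it is a subspace lattice turned upside down, so that downward counts are linear algebra
  inside \<open>x\<close>. Upwards, two vertices need not have a common bound. Upper covers are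
  therefore counted through the hyperplanes of a vertex, and those above another vertex by their
  intersection with it. A single factor \<open>r\<close> enters in one place only, the number of
  further vertices through such a hyperplane.\<close>

section \<open>Subspaces of a finite vector space\<close>

text \<open>The Gaussian number \<open>(b ^ n - 1) / (b - 1)\<close>.\<close>

definition gnum :: "nat \<Rightarrow> nat \<Rightarrow> nat" where
  "gnum b n = (\<Sum>j<n. b ^ j)"

lemma gnum_mult: "b > 0 \<Longrightarrow> (b - 1) * gnum b n = b ^ n - 1"
proof (induction n)
  case (Suc n)
  have "(b - 1) * gnum b (Suc n) = (b ^ n - 1) + (b - 1) * b ^ n"
    using Suc by (simp add: gnum_def algebra_simps)
  moreover have "b ^ n > 0" "b * b ^ n \<ge> b ^ n" using Suc.prems by simp_all
  ultimately show ?case by (simp add: diff_mult_distrib)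
qed (simp add: gnum_def)

lemma gnum_add: "gnum b (m + n) = gnum b m + b ^ m * gnum b n"
  by (induction n) (auto simp: gnum_def sum_distrib_left power_add algebra_simps)

lemma gnum_0 [simp]: "gnum b 0 = 0"
  and gnum_1 [simp]: "gnum b (Suc 0) = 1"
  and gnum_2: "gnum b 2 = b + 1"
  by (simp_all add: gnum_def numeral_eq_Suc)

lemma gnum_Suc: "gnum b (Suc n) = 1 + b * gnum b n"
  using gnum_add[of b 1 n] by simp

lemma gnum_mono: "m \<le> n \<Longrightarrow> gnum b m \<le> gnum b n"
  by (simp add: gnum_def sum_mono2)

locale finite_space = finite_dimensional_vector_space scale Basis
  for scale :: "'k::{field,finite} \<Rightarrow> 'v::ab_group_add \<Rightarrow> 'v" and Basis :: "'v set"
begin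

definition ssum :: "'v set \<Rightarrow> 'v set \<Rightarrow> 'v set" (infixl "\<boxplus>" 65) where
  "U \<boxplus> W = {u + w | u w. u \<in> U \<and> w \<in> W}"

lemma subspace_ssum: "subspace U \<Longrightarrow> subspace W \<Longrightarrow> subspace (U \<boxplus> W)"
  unfolding ssum_def by (rule subspace_sums)

lemma ssum_upper1: "subspace W \<Longrightarrow> U \<subseteq> U \<boxplus> W"
  unfolding ssum_def using subspace_0 by force

lemma ssum_upper2: "subspace U \<Longrightarrow> W \<subseteq> U \<boxplus> W"
  unfolding ssum_def using subspace_0 by force

lemma ssum_least: "subspace S \<Longrightarrow> U \<subseteq> S \<Longrightarrow> W \<subseteq> S \<Longrightarrow> U \<boxplus> W \<subseteq> S"
  unfolding ssum_def using subspace_add by blast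

lemma ssum_mono: "U \<subseteq> U' \<Longrightarrow> W \<subseteq> W' \<Longrightarrow> U \<boxplus> W \<subseteq> U' \<boxplus> W'"
  unfolding ssum_def by blast

lemma ssum_commute: "U \<boxplus> W = W \<boxplus> U"
  unfolding ssum_def using add.commute by blast

lemma dim_ssum:
  "subspace U \<Longrightarrow> subspace W \<Longrightarrow> dim (U \<boxplus> W) + dim (U \<inter> W) = dim U + dim W"
  unfolding ssum_def by (rule dim_sums_Int)

lemma modular_law:
  assumes "subspace S" "U \<subseteq> S"
  shows "S \<inter> (U \<boxplus> W) = U \<boxplus> (S \<inter> W)"
proof -
  have "w \<in> S" if "u \<in> U" "u + w \<in> S" for u w
    using subspace_diff[OF assms(1) that(2), of u] that assms(2) by auto
  then show ?thesis
    unfolding ssum_def using assms subspace_add by blast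
qed

lemma eq_if_dim_le:
  "subspace U \<Longrightarrow> subspace W \<Longrightarrow> U \<subseteq> W \<Longrightarrow> dim W \<le> dim U \<Longrightarrow> U = W"
  using subspace_dim_equal by blast

section \<open>Finiteness and numbers of subspaces\<close>

lemma finite_space_UNIV: "finite (UNIV :: 'v set)"
proof -
  have "(UNIV :: 'v set) = span Basis" using span_Basis by simp
  also have "\<dots> = (\<lambda>u. \<Sum>v\<in>Basis. scale (u v) v) ` (Basis \<rightarrow>\<^sub>E UNIV)"
  proof -
    have "range (\<lambda>u. \<Sum>v\<in>Basis. scale (u v) v) \<subseteq>
      (\<lambda>u. \<Sum>v\<in>Basis. scale (u v) v) ` (Basis \<rightarrow>\<^sub>E UNIV)"
    proof clarify
      fix u :: "'v \<Rightarrow> 'k"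
      \<comment> \<open>The type of vectors is not a finite type. After restriction to
        \<open>Basis\<close> only finitely many coefficient functions into the finite field
        remain.\<close>
      have "(\<Sum>v\<in>Basis. scale (u v) v) = (\<Sum>v\<in>Basis. scale (restrict u Basis v) v)"
        by (rule sum.cong) auto
      then show "(\<Sum>v\<in>Basis. scale (u v) v) \<in>
          (\<lambda>u. \<Sum>v\<in>Basis. scale (u v) v) ` (Basis \<rightarrow>\<^sub>E UNIV)"
        by (rule image_eqI[of _ _ "restrict u Basis"]) auto
    qed
    then show ?thesis unfolding span_finite[OF finite_Basis] by blast
  qed
  finally have eq: "(UNIV :: 'v set) = (\<lambda>u. \<Sum>v\<in>Basis. scale (u v) v) ` (Basis \<rightarrow>\<^sub>E UNIV)" .
  show ?thesis
    unfolding eq by (intro finite_imageI finite_PiE finite_Basis finite)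
qed

lemma finite_vectors [simp]: "finite (A :: 'v set)"
  by (rule finite_subset[OF subset_UNIV finite_space_UNIV])

lemma finite_vector_sets [simp]: "finite (A :: 'v set set)"
  using finite_subset[OF subset_UNIV, of A] finite_space_UNIV by (simp add: Finite_Set.finite_set)

lemma card_span_independent:
  "finite B \<Longrightarrow> independent B \<Longrightarrow> card (span B) = card (UNIV :: 'k set) ^ card B"
proof (induction B rule: finite_induct)
  case (insert a B)
  have ind: "independent B" and a: "a \<notin> span B"
    using insert.prems insert.hyps independent_insert by auto
  define f where "f = (\<lambda>(c, v). scale c a + v)"
  have "span (insert a B) = f ` (UNIV \<times> span B)"
  proof
    show "span (insert a B) \<subseteq> f ` (UNIV \<times> span B)"
    proof
      fix v assume "v \<in> span (insert a B)"
      then obtain k where "v - scale k a \<in> span B" using span_breakdown_eq by blast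
      then show "v \<in> f ` (UNIV \<times> span B)"
        by (intro image_eqI[of _ _ "(k, v - scale k a)"]) (auto simp: f_def)
    qed
    show "f ` (UNIV \<times> span B) \<subseteq> span (insert a B)"
    proof (clarsimp simp: f_def)
      fix c v assume "v \<in> span B"
      moreover have "span B \<subseteq> span (insert a B)" by (rule span_mono) blast
      ultimately show "scale c a + v \<in> span (insert a B)"
        by (intro span_add span_scale) (auto intro: span_base)
    qed
  qed
  moreover have "inj_on f (UNIV \<times> span B)"
  proof (rule inj_onI, clarify)
    fix c v c' v' assume v: "v \<in> span B" "v' \<in> span B" and eq: "f (c, v) = f (c', v')"
    have "scale (c - c') a = v' - v"
      using eq by (simp add: f_def scale_left_diff_distrib algebra_simps)
    then have s: "scale (c - c') a \<in> span B" using v span_diff by simp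
    have "c = c'"
    proof (rule ccontr)
      assume "c \<noteq> c'"
      then have "a = scale (inverse (c - c')) (scale (c - c') a)" by simp
      then show False using span_scale[OF s] a by metis
    qed
    then show "c = c' \<and> v = v'" using eq by (simp add: f_def)
  qed
  ultimately have "card (span (insert a B)) = card (UNIV :: 'k set) * card (span B)"
    by (simp add: card_image card_cartesian_product)
  then show ?case using insert ind by simp
next
  case empty
  have "card (span {}) = 1" by (simp only: span_empty) simp
  then show ?case by (simp only: card.empty power_0)
qed

lemma card_subspace:
  assumes "subspace S"
  shows "card S = card (UNIV :: 'k set) ^ dim S"
proof -
  obtain B where B: "independent B" "finite B" "span B = S" "card B = dim S"
    using basis_subspace_exists[OF assms] by blast
  have "card (span B) = card (UNIV :: 'k set) ^ card B"
    using B(1,2) by (intro card_span_independent)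
  then show ?thesis unfolding B .
qed

lemma dim_ssum_span:
  assumes "subspace K" "v \<notin> K"
  shows "dim (K \<boxplus> span {v}) = Suc (dim K)"
proof -
  have "span (insert v K) = K \<boxplus> span {v}"
    using span_Un[of K "{v}"] span_eq_iff[THEN iffD2, OF assms(1)] unfolding ssum_def
    by (simp only: Un_insert_right Un_empty_right)
  moreover have "dim (span (insert v K)) = Suc (dim K)"
    using dim_insert[of v K] assms(2) unfolding span_eq_iff[THEN iffD2, OF assms(1)] dim_span by simp
  ultimately show ?thesis by simp
qed

text \<open>Each vector of \<open>S - K\<close> lies in exactly one of these subspaces, namely
  \<open>K \<boxplus> span {v}\<close>, and each of them has \<open>(b - 1) * b ^ dim K\<close>
  vectors outside \<open>K\<close>. The quotient of the two cardinalities is the Gaussian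
  number.\<close>

lemma card_extensions:
  assumes K: "subspace K" and S: "subspace S" and KS: "K \<subseteq> S"
  shows "card {H. subspace H \<and> K \<subseteq> H \<and> H \<subseteq> S \<and> dim H = Suc (dim K)} =
    gnum (card (UNIV :: 'k set)) (dim S - dim K)"
proof -
  define b where "b = card (UNIV :: 'k set)"
  define F where "F = {H. subspace H \<and> K \<subseteq> H \<and> H \<subseteq> S \<and> dim H = Suc (dim K)}"
  have b: "b > 1"
  proof -
    have "card {0, 1 :: 'k} \<le> b" unfolding b_def by (rule card_mono) auto
    then show ?thesis by simp
  qed
  have ext: "\<exists>H\<in>F. v \<in> H" if v: "v \<in> S" "v \<notin> K" for v
  proof
    show "v \<in> K \<boxplus> span {v}" using ssum_upper2[OF K, of "span {v}"] span_base[of v "{v}"] by blast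
    have "span {v} \<subseteq> S" using span_minimal[of "{v}" S] S v by simp
    then show "K \<boxplus> span {v} \<in> F"
      using dim_ssum_span[OF K v(2)] ssum_upper1[of "span {v}" K] ssum_least[OF S KS] subspace_ssum[OF K]
      by (simp add: F_def)
  qed
  have uniq: "H = K \<boxplus> span {v}" if H: "H \<in> F" "v \<in> H" "v \<notin> K" for v H
  proof -
    have "span {v} \<subseteq> H" using span_minimal[of "{v}" H] H by (simp add: F_def)
    then have "K \<boxplus> span {v} \<subseteq> H" using H by (intro ssum_least) (auto simp: F_def)
    then show ?thesis
      using eq_if_dim_le[of "K \<boxplus> span {v}" H] H dim_ssum_span[OF K H(3)] subspace_ssum[OF K]
      by (simp add: F_def)
  qed
  have "S - K = (\<Union>H\<in>F. H - K)"
    using ext by (auto simp: F_def)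
  moreover have "(H - K) \<inter> (H' - K) = {}" if "H \<in> F" "H' \<in> F" "H \<noteq> H'" for H H'
    using uniq that by blast
  ultimately have "card (S - K) = (\<Sum>H\<in>F. card (H - K))"
    by (simp only:) (rule card_UN_disjoint, auto)
  also have "\<dots> = (\<Sum>H\<in>F. b ^ Suc (dim K) - b ^ dim K)"
    by (rule sum.cong) (auto simp: F_def b_def card_Diff_subset card_subspace K)
  also have "\<dots> = card F * ((b - 1) * b ^ dim K)"
    by (simp add: diff_mult_distrib)
  finally have "b ^ dim S - b ^ dim K = card F * ((b - 1) * b ^ dim K)"
    by (simp add: card_Diff_subset KS card_subspace K S b_def)
  moreover have "b ^ dim S = b ^ (dim S - dim K) * b ^ dim K"
    using dim_subset[OF KS] by (simp flip: power_add)
  ultimately have "(b ^ (dim S - dim K) - 1) * b ^ dim K = ((b - 1) * card F) * b ^ dim K"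
    by (simp add: diff_mult_distrib diff_mult_distrib2 mult.commute mult.left_commute)
  then have "b ^ (dim S - dim K) - 1 = (b - 1) * card F" using b by simp
  then have "(b - 1) * gnum b (dim S - dim K) = (b - 1) * card F" using gnum_mult[of b] b by simp
  then show ?thesis using b unfolding F_def b_def by simp
qed

end

section \<open>Isotropic subspaces and the geodesic order\<close>

context hermitian_space
begin

lemma form_zero [simp]: "h 0 v = 0"
  using form_scale[of 0 0 v] by simp

lemma r_gt_1: "r > 1"
proof -
  have "card {0, 1 :: 'k} \<le> card (UNIV :: 'k set)" by (rule card_mono) auto
  then have "2 \<le> r ^ 2" using card_field by simp
  then show ?thesis by (cases r; cases "r - 1") auto
qed

lemma form_swap_zero: "h u v = 0 \<longleftrightarrow> h v u = 0"
  using form_hermitian r_gt_1 by (metis power_eq_0_iff)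

text \<open>The form is linear in its first argument only. With the varying vector there, closure
  under addition and scaling is immediate for every set \<open>U\<close>.\<close>

definition perp :: "'v set \<Rightarrow> 'v set" where
  "perp U = {v. \<forall>u\<in>U. h v u = 0}"

lemma subspace_perp: "subspace (perp U)"
  unfolding perp_def by (rule subspaceI) (auto simp: form_add form_scale)

lemma perp_antimono: "U \<subseteq> W \<Longrightarrow> perp W \<subseteq> perp U"
  unfolding perp_def by blast

lemma subset_perp_swap: "U \<subseteq> perp W \<longleftrightarrow> W \<subseteq> perp U"
  unfolding perp_def using form_swap_zero by blast

lemma perp_perp_superset: "U \<subseteq> perp (perp U)"
  using subset_perp_swap[of "perp U" U] by simp

text \<open>By \<open>subset_perp_swap\<close> the map \<open>perp\<close> is a Galois connection
  with itself. The set \<open>perp (perp U)\<close> is a subspace containing \<open>U\<close>, hence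
  it contains \<open>span U\<close>.\<close>

lemma perp_span: "perp (span U) = perp U"
proof (rule antisym)
  show "perp U \<subseteq> perp (span U)"
    using span_minimal[OF perp_perp_superset subspace_perp] subset_perp_swap[of "span U" "perp U"] by blast
qed (simp add: perp_antimono span_superset)

lemma perp_Un: "perp (U \<union> W) = perp U \<inter> perp W"
  unfolding perp_def by blast

lemma perp_UNIV: "perp UNIV = {0}"
  unfolding perp_def using form_nondegenerate by auto

text \<open>Both \<open>card\<close> and \<open>dim\<close> return 0 in the infinite case, so the
  positive dimension \<open>2 * D\<close> certifies that the basis is finite.\<close>

lemma ex_finite_basis:
  assumes "D > 0"
  shows "\<exists>B. finite B \<and> independent B \<and> span B = UNIV"
proof -
  obtain B where B: "independent B" "UNIV \<subseteq> span B" "card B = dim UNIV"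
    using basis_exists[of UNIV] by auto
  then have "card B > 0" using dim_space assms by simp
  then show ?thesis using B card_gt_0_iff by blast
qed

text \<open>The locale \<open>finite_space\<close> takes a basis as a parameter. Fixing one by
  choice supplies it to the sublocale below.\<close>

definition some_basis :: "'v set" where
  "some_basis = (SOME B. finite B \<and> independent B \<and> span B = UNIV)"

end

section \<open>Dimensions of complements, vertices and projections\<close>

locale dual_polar = hermitian_space scale r D h
  for scale :: "'k::{field,finite} \<Rightarrow> 'v::ab_group_add \<Rightarrow> 'v"
    and r :: nat and D :: nat and h :: "'v \<Rightarrow> 'v \<Rightarrow> 'k" +
  fixes x :: "'v set"
  assumes D_pos: "D > 0"
    and x_vertex: "x \<in> dual_polar_vertices"
begin

sublocale finite_space scale some_basis
  using someI_ex[OF ex_finite_basis[OF D_pos]]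
  by unfold_locales (auto simp: some_basis_def)

abbreviation "X \<equiv> dual_polar_vertices"

lemma perp_ssum: "subspace U \<Longrightarrow> subspace W \<Longrightarrow> perp (U \<boxplus> W) = perp U \<inter> perp W"
  using span_Un[of U W] perp_span[of "U \<union> W"] unfolding ssum_def perp_Un
  by (simp only: span_eq_iff[THEN iffD2])

text \<open>One linear condition costs at most one dimension: if \<open>h s a\<close> is nonzero for
  some \<open>s\<close> in \<open>S\<close>, each vector of \<open>S\<close> becomes orthogonal to
  \<open>a\<close> after adding a multiple of \<open>s\<close>.\<close>

lemma dim_Int_perp_singleton:
  assumes S: "subspace S"
  shows "dim S \<le> Suc (dim (S \<inter> perp {a}))"
proof (cases "S \<subseteq> perp {a}")
  case True
  then show ?thesis by (simp add: Int_absorb2)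
next
  case False
  then obtain s where s: "s \<in> S" "h s a \<noteq> 0" unfolding perp_def by blast
  have "S \<subseteq> span (insert s (S \<inter> perp {a}))"
  proof
    fix v assume v: "v \<in> S"
    define k where "k = - (h v a / h s a)"
    have "v + scale k s \<in> S" by (intro subspace_add subspace_scale S v s)
    moreover have "h (v + scale k s) a = 0"
      using s(2) by (simp only: form_add form_scale k_def) simp
    ultimately have "v + scale k s \<in> S \<inter> perp {a}" by (simp add: perp_def)
    then have "v - scale (- k) s \<in> span (S \<inter> perp {a})" by (intro span_base) simp
    then show "v \<in> span (insert s (S \<inter> perp {a}))" using span_breakdown_eq by blast
  qed
  then have "dim S \<le> dim (insert s (S \<inter> perp {a}))" by (rule dim_mono)
  then show ?thesis using dim_insert[of s "S \<inter> perp {a}"] by (auto split: if_splits)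
qed

lemma dim_perp_Un: "finite C \<Longrightarrow> dim (perp B) \<le> dim (perp (B \<union> C)) + card C"
proof (induction C rule: finite_induct)
  case (insert a C)
  have "perp (B \<union> insert a C) = perp (B \<union> C) \<inter> perp {a}"
    using perp_Un[of "B \<union> C" "{a}"] by (simp add: Un_commute)
  then show ?case
    using insert dim_Int_perp_singleton[OF subspace_perp[of "B \<union> C"], of a] by simp
qed simp

text \<open>Extend a basis \<open>B\<close> of \<open>U\<close> to a basis \<open>C\<close> of the
  whole space. From \<open>perp {}\<close>, which is everything, to \<open>perp B\<close> the
  dimension drops by at most \<open>card B\<close>, and from there to \<open>perp C\<close>, which
  is zero by nondegeneracy, by at most \<open>card (C - B)\<close>. Each of the two drops gives one
  inequality.\<close>

lemma dim_perp:
  assumes U: "subspace U"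
  shows "dim (perp U) + dim U = 2 * D"
proof (rule antisym)
  obtain B where B: "independent B" "span B = U" "card B = dim U"
    using basis_subspace_exists[OF U] by metis
  have perp_B: "perp B = perp U" using perp_span[of B] B by simp
  have "perp {} = UNIV" by (simp add: perp_def)
  then show "2 * D \<le> dim (perp U) + dim U"
    using dim_perp_Un[of B "{}"] B perp_B dim_space by (simp add: finiteI_independent)
  obtain C where C: "B \<subseteq> C" "independent C" "UNIV \<subseteq> span C"
    using maximal_independent_subset_extend[of B UNIV] B by auto
  have fC: "finite C" using C finiteI_independent by blast
  have "span C = UNIV" using C by blast
  then have "card C = 2 * D" using C dim_space dim_span_eq_card_independent by metis
  moreover have "perp (B \<union> (C - B)) = {0}"
    using perp_span[of C] perp_UNIV C \<open>span C = UNIV\<close> by (simp add: Un_absorb1)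
  moreover have "card (C - B) + card B = card C"
    using C(1) fC by (metis card_Diff_subset card_mono finite_subset le_add_diff_inverse2)
  ultimately show "dim (perp U) + dim U \<le> 2 * D"
    using dim_perp_Un[of "C - B" B] fC B perp_B by simp
qed

lemma perp_perp:
  assumes "subspace U"
  shows "perp (perp U) = U"
proof (rule eq_if_dim_le[symmetric])
  show "U \<subseteq> perp (perp U)" by (rule perp_perp_superset)
  show "dim (perp (perp U)) \<le> dim U"
    using dim_perp[OF assms] dim_perp[OF subspace_perp, of U] by simp
qed (use assms subspace_perp in auto)

text \<open>A vertex lies in its complement and both have dimension \<open>D\<close>. Conversely
  \<open>perp y = y\<close> forces dimension \<open>D\<close>, and every isotropic subspace
  containing \<open>y\<close> lies in \<open>perp y\<close>. Later arguments use this equation in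
  place of maximality.\<close>

lemma vertex_iff: "y \<in> X \<longleftrightarrow> subspace y \<and> perp y = y"
proof
  assume "y \<in> X"
  then have y: "subspace y" "y \<subseteq> perp y" "dim y = D"
    unfolding dual_polar_vertices_def totally_isotropic_def perp_def by auto
  then have "y = perp y"
    using dim_perp[OF y(1)] by (intro eq_if_dim_le) (auto simp: subspace_perp)
  then show "subspace y \<and> perp y = y" using y by simp
next
  assume y: "subspace y \<and> perp y = y"
  then have "dim y = D" using dim_perp[of y] by simp
  moreover have "totally_isotropic y"
    using y unfolding totally_isotropic_def perp_def by blast
  moreover have "W = y" if "totally_isotropic W" "y \<subseteq> W" for W
  proof -
    have "W \<subseteq> perp y" using that unfolding totally_isotropic_def perp_def by blast
    then show ?thesis using y that by blast
  qed
  ultimately show "y \<in> X" unfolding dual_polar_vertices_def by blast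
qed

lemma
  assumes "y \<in> X"
  shows vertex_subspace: "subspace y"
    and vertex_perp: "perp y = y"
    and vertex_dim: "dim y = D"
  using assms vertex_iff dim_perp[of y] by auto

lemma vertex_eqI:
  assumes "y \<in> X" "z \<in> X" "y \<subseteq> z"
  shows "y = z"
  using assms perp_antimono[of y z] vertex_perp by blast

lemma isotropic_subset_perp: "z \<in> X \<Longrightarrow> U \<subseteq> z \<Longrightarrow> W \<subseteq> z \<Longrightarrow> U \<subseteq> perp W"
  using vertex_perp perp_antimono[of W z] by blast

lemmas x_subspace = vertex_subspace[OF x_vertex]

text \<open>Since \<open>y\<close> is its own complement, \<open>perp A \<inter> y\<close> is the
  complement of \<open>A \<boxplus> y\<close>.\<close>

lemma dim_perp_Int_vertex:
  assumes "subspace A" "y \<in> X"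
  shows "dim (perp A \<inter> y) + dim A = D + dim (A \<inter> y)"
proof -
  have "perp A \<inter> y = perp (A \<boxplus> y)"
    using assms perp_ssum vertex_subspace vertex_perp by metis
  then show ?thesis
    using dim_perp[of "A \<boxplus> y"] dim_ssum[of A y] assms vertex_subspace[of y] vertex_dim[of y]
      subspace_ssum by fastforce
qed

text \<open>For isotropic \<open>A\<close> this is the vertex through \<open>A\<close> nearest to
  \<open>z\<close>: a vertex through \<open>A\<close> lies in \<open>perp A\<close> and so meets
  \<open>z\<close> at most in \<open>perp A \<inter> z\<close>, all of which is adjoined
  here.\<close>

definition proj :: "'v set \<Rightarrow> 'v set \<Rightarrow> 'v set" where
  "proj A z = A \<boxplus> (perp A \<inter> z)"

text \<open>Self-orthogonality is the modular law: the complement of the projection is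
  \<open>perp A \<inter> (A \<boxplus> z)\<close>, and \<open>A\<close> is contained in
  \<open>perp A\<close>.\<close>

lemma proj_vertex:
  assumes A: "subspace A" "A \<subseteq> perp A" and z: "z \<in> X"
  shows "proj A z \<in> X"
proof -
  have s: "subspace z" "subspace (perp A \<inter> z)"
    using z vertex_subspace subspace_perp subspace_inter by auto
  have "perp A \<inter> z = perp (A \<boxplus> z)"
    using A s(1) z perp_ssum vertex_perp by metis
  then have "perp (perp A \<inter> z) = A \<boxplus> z"
    using perp_perp A s subspace_ssum by metis
  then have "perp (proj A z) = proj A z"
    unfolding proj_def using perp_ssum[OF A(1) s(2)] modular_law[OF subspace_perp A(2)] by simp
  then show ?thesis unfolding vertex_iff using A s subspace_ssum by (simp add: proj_def)
qed

text \<open>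
  For vertices this says that \<open>y\<close> lies on a geodesic from \<open>x\<close> to \<open>z\<close>; in coordinates where \<open>z\<close> is
  the graph of a Hermitian form on a subspace \<open>W\<close> of the dual of \<open>x\<close>, it says that \<open>y\<close> is the
  restriction of that form to a subspace of \<open>W\<close>.
\<close>

definition below :: "'v set \<Rightarrow> 'v set \<Rightarrow> bool" where
  "below y z \<longleftrightarrow> y \<subseteq> z \<boxplus> (x \<inter> y)"

lemma subspace_x_Int: "y \<in> X \<Longrightarrow> subspace (x \<inter> y)"
  using x_subspace vertex_subspace subspace_inter by blast

lemma x_Int_proj:
  assumes A: "subspace A" "A \<subseteq> x" and z: "z \<in> X" "x \<inter> z \<subseteq> A"
  shows "x \<inter> proj A z = A"
proof -
  have "x \<inter> proj A z = A \<boxplus> (x \<inter> (perp A \<inter> z))"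
    unfolding proj_def using modular_law[OF x_subspace A(2)] .
  also have "\<dots> = A"
  proof (rule antisym)
    show "A \<boxplus> (x \<inter> (perp A \<inter> z)) \<subseteq> A" using z by (intro ssum_least A(1)) auto
    show "A \<subseteq> A \<boxplus> (x \<inter> (perp A \<inter> z))"
      using z(1) x_subspace vertex_subspace subspace_perp by (intro ssum_upper1 subspace_inter) auto
  qed
  finally show ?thesis .
qed

lemma below_proj:
  assumes A: "subspace A" "A \<subseteq> x" and z: "z \<in> X" "x \<inter> z \<subseteq> A"
  shows "proj A z \<in> X" and "below (proj A z) z"
proof -
  show "proj A z \<in> X"
    using A z isotropic_subset_perp[OF x_vertex A(2) A(2)] by (intro proj_vertex)
  show "below (proj A z) z"
    unfolding below_def x_Int_proj[OF assms] unfolding proj_def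
    using ssum_mono[of A A "perp A \<inter> z" z] ssum_commute by blast
qed

text \<open>Taking complements in the definition of \<open>below\<close> shows that
  \<open>perp (x \<inter> y) \<inter> z\<close> is contained in \<open>y\<close>. So the projection
  lies in \<open>y\<close>, and nested vertices are equal. Below a fixed \<open>z\<close> a vertex
  is thus determined by its trace on \<open>x\<close>.\<close>

lemma below_eq_proj:
  assumes y: "y \<in> X" and z: "z \<in> X" and "below y z"
  shows "y = proj (x \<inter> y) z"
proof (rule vertex_eqI[symmetric])
  have s: "subspace (x \<inter> y)" using subspace_x_Int[OF y] .
  show "proj (x \<inter> y) z \<in> X"
    using isotropic_subset_perp[OF x_vertex] s z by (intro proj_vertex) auto
  have "perp (x \<inter> y) \<inter> z = perp (z \<boxplus> (x \<inter> y))"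
    using perp_ssum[OF _ s] vertex_perp z vertex_subspace by (simp add: Int_commute)
  also have "\<dots> \<subseteq> perp y" using assms(3) perp_antimono by (simp add: below_def)
  finally have "perp (x \<inter> y) \<inter> z \<subseteq> y" using vertex_perp[OF y] by simp
  then show "proj (x \<inter> y) z \<subseteq> y"
    unfolding proj_def using vertex_subspace[OF y] by (intro ssum_least) auto
qed (use y in simp)

lemma below_unique:
  "y \<in> X \<Longrightarrow> y' \<in> X \<Longrightarrow> z \<in> X \<Longrightarrow> below y z \<Longrightarrow> below y' z \<Longrightarrow> x \<inter> y = x \<inter> y' \<Longrightarrow> y = y'"
  using below_eq_proj by metis

lemma below_Int_subset:
  assumes y: "y \<in> X" and z: "z \<in> X" and "below y z"
  shows "x \<inter> z \<subseteq> x \<inter> y"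
proof -
  have "x \<inter> z \<subseteq> perp (x \<inter> y) \<inter> z"
    using isotropic_subset_perp[OF x_vertex, of "x \<inter> z" "x \<inter> y"] by blast
  also have "\<dots> \<subseteq> proj (x \<inter> y) z"
    unfolding proj_def using subspace_x_Int[OF y] by (rule ssum_upper2)
  finally show ?thesis using below_eq_proj[OF assms] by blast
qed

lemma below_trans:
  assumes "y \<in> X" "z \<in> X" "w \<in> X" and yz: "below y z" and zw: "below z w"
  shows "below y w"
proof -
  have s: "subspace (w \<boxplus> (x \<inter> y))"
    using assms vertex_subspace subspace_x_Int subspace_ssum by blast
  have "w \<boxplus> (x \<inter> z) \<subseteq> w \<boxplus> (x \<inter> y)"
    using below_Int_subset assms by (intro ssum_mono) auto
  then have "z \<subseteq> w \<boxplus> (x \<inter> y)" using zw below_def by blast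
  moreover have "x \<inter> y \<subseteq> w \<boxplus> (x \<inter> y)" using assms vertex_subspace by (intro ssum_upper2)
  ultimately have "z \<boxplus> (x \<inter> y) \<subseteq> w \<boxplus> (x \<inter> y)" by (rule ssum_least[OF s])
  then show ?thesis using yz below_def by blast
qed

text \<open>Below a common \<open>w\<close> the order is reversed inclusion of traces: both vertices
  are projections of \<open>w\<close>, and the larger trace has the smaller complement.\<close>

lemma below_of_below:
  assumes X: "y \<in> X" "z \<in> X" "w \<in> X" and le: "below y w" "below z w"
    and sub: "x \<inter> z \<subseteq> x \<inter> y"
  shows "below y z"
proof -
  have "perp (x \<inter> y) \<inter> w \<subseteq> perp (x \<inter> z) \<inter> w" using perp_antimono[OF sub] by blast
  also have "\<dots> \<subseteq> z"
    using below_eq_proj[OF X(2,3) le(2)] ssum_upper2[OF subspace_x_Int[OF X(2)]]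
    unfolding proj_def by blast
  finally have "proj (x \<inter> y) w \<subseteq> (x \<inter> y) \<boxplus> z" unfolding proj_def by (intro ssum_mono) auto
  then show ?thesis
    unfolding below_def using below_eq_proj[OF X(1,3) le(1)] ssum_commute by metis
qed

text \<open>By the modular law \<open>y\<close> is the sum of \<open>x \<inter> y\<close> and
  \<open>y \<inter> z\<close>, which meet in \<open>x \<inter> z\<close>. Read with distances as
  codimensions of intersections, the equation says that the distances from \<open>x\<close> to
  \<open>y\<close> and from \<open>y\<close> to \<open>z\<close> add up.\<close>

lemma below_dim:
  assumes y: "y \<in> X" and z: "z \<in> X" and le: "below y z"
  shows "dim (y \<inter> z) + dim (x \<inter> y) = D + dim (x \<inter> z)"
proof -
  have "y = y \<inter> ((x \<inter> y) \<boxplus> z)" using le ssum_commute unfolding below_def by blast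
  also have "\<dots> = (x \<inter> y) \<boxplus> (y \<inter> z)"
    using modular_law[OF vertex_subspace[OF y], of "x \<inter> y" z] by blast
  finally have "dim ((x \<inter> y) \<boxplus> (y \<inter> z)) = D" using vertex_dim[OF y] by simp
  moreover have "(x \<inter> y) \<inter> (y \<inter> z) = x \<inter> z" using below_Int_subset[OF assms] by blast
  ultimately show ?thesis
    using dim_ssum[of "x \<inter> y" "y \<inter> z"] subspace_x_Int[OF y] subspace_inter vertex_subspace y z
    by (simp add: add.commute)
qed

lemma belowI_dim:
  assumes y: "y \<in> X" and z: "z \<in> X"
    and le: "D + dim (x \<inter> z) \<le> dim (y \<inter> z) + dim (x \<inter> y)"
  shows "below y z"
proof -
  have s: "subspace (x \<inter> y)" "subspace (y \<inter> z)"
    using subspace_x_Int y z subspace_inter vertex_subspace by auto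
  have "dim ((x \<inter> y) \<inter> (y \<inter> z)) \<le> dim (x \<inter> z)" by (rule dim_subset) blast
  then have "D \<le> dim ((x \<inter> y) \<boxplus> (y \<inter> z))" using dim_ssum[OF s] le by linarith
  then have "(x \<inter> y) \<boxplus> (y \<inter> z) = y"
    using y vertex_subspace s by (intro eq_if_dim_le subspace_ssum ssum_least) (auto simp: vertex_dim)
  moreover have "(x \<inter> y) \<boxplus> (y \<inter> z) \<subseteq> (x \<inter> y) \<boxplus> z" by (intro ssum_mono) auto
  ultimately show ?thesis unfolding below_def using ssum_commute by metis
qed

definition cov :: "'v set \<Rightarrow> 'v set \<Rightarrow> bool" where
  "cov y z \<longleftrightarrow> y \<in> X \<and> z \<in> X \<and> below y z \<and> dim (x \<inter> y) = Suc (dim (x \<inter> z))"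

lemma cov_iff_adjacent:
  "cov y z \<longleftrightarrow> y \<in> X \<and> z \<in> X \<and> dim (y \<inter> z) = D - 1 \<and> dim (x \<inter> y) = Suc (dim (x \<inter> z))"
  unfolding cov_def using below_dim[of y z] belowI_dim[of y z] D_pos by auto

text \<open>Taking traces is a bijection onto the subspaces between \<open>x \<inter> z\<close> and
  \<open>x \<inter> y\<close> that are one dimension larger than \<open>x \<inter> z\<close>; its
  inverse is projection of \<open>z\<close>.\<close>

lemma card_interval:
  assumes y: "y \<in> X" and z: "z \<in> X" and le: "below y z"
  shows "card {u. cov u z \<and> below y u} = gnum (r\<^sup>2) (dim (x \<inter> y) - dim (x \<inter> z))"
proof -
  define F where "F = {A. subspace A \<and> x \<inter> z \<subseteq> A \<and> A \<subseteq> x \<inter> y \<and> dim A = Suc (dim (x \<inter> z))}"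
  have "bij_betw (\<lambda>u. x \<inter> u) {u. cov u z \<and> below y u} F"
  proof (rule bij_betwI[where g = "\<lambda>A. proj A z"])
    show "(\<lambda>u. x \<inter> u) \<in> {u. cov u z \<and> below y u} \<rightarrow> F"
      using below_Int_subset[OF _ z] below_Int_subset[OF y] subspace_x_Int
      unfolding F_def cov_def by auto
    show "(\<lambda>A. proj A z) \<in> F \<rightarrow> {u. cov u z \<and> below y u}"
    proof (rule Pi_I)
      fix A assume A: "A \<in> F"
      then have A': "subspace A" "A \<subseteq> x" "x \<inter> z \<subseteq> A" "A \<subseteq> x \<inter> y" unfolding F_def by auto
      note p = below_proj[OF A'(1,2) z A'(3)] x_Int_proj[OF A'(1,2) z A'(3)]
      have "below y (proj A z)" using below_of_below[OF y p(1) z le p(2)] p(3) A' by simp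
      then show "proj A z \<in> {u. cov u z \<and> below y u}"
        using p A z unfolding cov_def F_def by simp
    qed
    show "proj (x \<inter> u) z = u" if "u \<in> {u. cov u z \<and> below y u}" for u
      using that below_eq_proj[OF _ z] unfolding cov_def by simp
    show "x \<inter> proj A z = A" if "A \<in> F" for A
      using that x_Int_proj z unfolding F_def by blast
  qed
  then have "card {u. cov u z \<and> below y u} = card F" by (rule bij_betw_same_card)
  then show ?thesis
    unfolding F_def
    using card_extensions[OF subspace_x_Int[OF z] subspace_x_Int[OF y] below_Int_subset[OF assms]] card_field
    by simp
qed

end

section \<open>Neighbours of a vertex\<close>

lemma card_trinomial_roots:
  fixes a b :: "'k::field"
  assumes "r > 1"
  shows "card {s. s ^ r + a * s + b = 0} \<le> r"
proof -
  define p where "p = monom 1 r + [:b, a:]"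
  have "degree [:b, a:] < degree (monom (1 :: 'k) r)"
    using assms by (simp add: degree_monom_eq)
  then have deg: "degree p = r" unfolding p_def
    using degree_add_eq_left[of "[:b, a:]" "monom 1 r"] by (simp add: degree_monom_eq)
  have "p \<noteq> 0" using deg assms by auto
  moreover have roots: "{s. s ^ r + a * s + b = 0} = {s. poly p s = 0}"
    by (auto simp: p_def poly_monom algebra_simps)
  ultimately show ?thesis
    using card_poly_roots_bound[of p] deg by simp
qed

text \<open>
  Pigeonhole: each of the at most \<open>r\<close> fixed points of \<open>e \<mapsto> e ^ r\<close> has at most \<open>r\<close> preimages under
  \<open>s \<mapsto> s ^ r + s - c\<close>, and together these fibres exhaust the \<open>r\<^sup>2\<close> elements of the field.
  Stated this way, the additivity of \<open>s \<mapsto> s ^ r\<close> is never needed: the values of the Hermitian form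
  on vectors are fixed points by symmetry.
\<close>

lemma card_fiber_eq:
  fixes c :: "'k::{field,finite}"
  assumes r: "r > 1" and card: "card (UNIV :: 'k set) = r\<^sup>2"
    and fixed: "\<And>s :: 'k. (s ^ r + s - c) ^ r = s ^ r + s - c"
  shows "card {s. s ^ r + s = c} = r"
proof -
  define F where "F = {e :: 'k. e ^ r = e}"
  define fib where "fib e = {s. s ^ r + s - c = e}" for e :: 'k
  have F: "card F \<le> r"
    using card_trinomial_roots[OF r, of "-1" "0 :: 'k"] by (simp add: F_def)
  have fib: "card (fib e) \<le> r" for e
    using card_trinomial_roots[OF r, of "1" "- c - e :: 'k"]
    by (simp add: fib_def algebra_simps)
  have "0 \<in> F" using r by (simp add: F_def)
  have "UNIV = (\<Union>e\<in>F. fib e)" using fixed by (auto simp: F_def fib_def)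
  then have "r\<^sup>2 = card (\<Union>e\<in>F. fib e)" using card by simp
  also have "\<dots> = (\<Sum>e\<in>F. card (fib e))"
    by (rule card_UN_disjoint) (auto simp: fib_def)
  also have "\<dots> = card (fib 0) + (\<Sum>e\<in>F - {0}. card (fib e))"
    using \<open>0 \<in> F\<close> by (simp add: sum.remove)
  also have "\<dots> \<le> card (fib 0) + (card F - 1) * r"
    using sum_bounded_above[of "F - {0}" "\<lambda>e. card (fib e)" r] fib \<open>0 \<in> F\<close>
    by (simp add: card_Diff_singleton)
  also have "\<dots> \<le> card (fib 0) + (r - 1) * r" by (intro add_left_mono mult_le_mono1 diff_le_mono F)
  finally have "r\<^sup>2 \<le> card (fib 0) + (r - 1) * r" .
  moreover have "r\<^sup>2 = r + (r - 1) * r" using r by (cases r) (auto simp: power2_eq_square)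
  ultimately have "r \<le> card (fib 0)" by simp
  then show ?thesis using fib[of 0] by (simp add: fib_def)
qed

section \<open>Hyperplanes of a vertex and its upper covers\<close>

context dual_polar
begin

text \<open>Complementation reverses inclusion and matches these hyperplanes with the subspaces of
  dimension \<open>D + 1\<close> between \<open>y\<close> and \<open>perp A\<close>, which
  \<open>card_extensions\<close> counts.\<close>

lemma card_hyperplanes:
  assumes y: "y \<in> X" and A: "subspace A" "A \<subseteq> y"
  shows "card {H. subspace H \<and> A \<subseteq> H \<and> H \<subseteq> y \<and> dim H = D - 1} = gnum (r\<^sup>2) (D - dim A)"
proof -
  define F where "F = {H. subspace H \<and> A \<subseteq> H \<and> H \<subseteq> y \<and> dim H = D - 1}"
  define G where "G = {M. subspace M \<and> y \<subseteq> M \<and> M \<subseteq> perp A \<and> dim M = Suc (dim y)}"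
  have "bij_betw perp F G"
  proof (rule bij_betwI[where g = perp])
    show "perp \<in> F \<rightarrow> G"
    proof (rule Pi_I)
      fix H assume "H \<in> F"
      then have H: "subspace H" "A \<subseteq> H" "H \<subseteq> y" "dim H = D - 1" unfolding F_def by auto
      have "y \<subseteq> perp H" using perp_antimono[OF H(3)] vertex_perp[OF y] by simp
      then show "perp H \<in> G"
        using H dim_perp[OF H(1)] subspace_perp perp_antimono[OF H(2)] vertex_dim[OF y] D_pos
        unfolding G_def by auto
    qed
    show "perp \<in> G \<rightarrow> F"
    proof (rule Pi_I)
      fix M assume "M \<in> G"
      then have M: "subspace M" "y \<subseteq> M" "M \<subseteq> perp A" "dim M = Suc (dim y)" unfolding G_def by auto
      have "perp M \<subseteq> y" using perp_antimono[OF M(2)] vertex_perp[OF y] by simp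
      moreover have "A \<subseteq> perp M" using M(3) subset_perp_swap[of M A] by simp
      ultimately show "perp M \<in> F"
        using M dim_perp[OF M(1)] subspace_perp vertex_dim[OF y] unfolding F_def by auto
    qed
  qed (auto simp: F_def G_def perp_perp)
  then have "card F = card G" by (rule bij_betw_same_card)
  also have "\<dots> = gnum (r\<^sup>2) (dim (perp A) - dim y)"
    unfolding G_def card_field[symmetric]
    using vertex_subspace[OF y] subspace_perp perp_antimono[OF A(2)] vertex_perp[OF y]
    by (intro card_extensions) auto
  also have "dim (perp A) - dim y = D - dim A"
    using dim_perp[OF A(1)] vertex_dim[OF y] by simp
  finally show ?thesis unfolding F_def .
qed

lemma card_hyperplanes_diff:
  assumes y: "y \<in> X" and A: "subspace A" "A \<subseteq> y" and B: "subspace B" "B \<subseteq> y"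
  shows "card {H. subspace H \<and> A \<subseteq> H \<and> H \<subseteq> y \<and> dim H = D - 1 \<and> \<not> B \<subseteq> H}
    = gnum (r\<^sup>2) (D - dim A) - gnum (r\<^sup>2) (D - dim (A \<boxplus> B))"
proof -
  let ?F = "\<lambda>A. {H. subspace H \<and> A \<subseteq> H \<and> H \<subseteq> y \<and> dim H = D - 1}"
  have "A \<boxplus> B \<subseteq> H \<longleftrightarrow> A \<subseteq> H \<and> B \<subseteq> H" if "subspace H" for H
    using that ssum_least ssum_upper1[OF B(1), of A] ssum_upper2[OF A(1), of B] by blast
  then have "{H. subspace H \<and> A \<subseteq> H \<and> H \<subseteq> y \<and> dim H = D - 1 \<and> \<not> B \<subseteq> H}
      = ?F A - ?F (A \<boxplus> B)" and "?F (A \<boxplus> B) \<subseteq> ?F A"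
    by blast+
  moreover have "subspace (A \<boxplus> B)" "A \<boxplus> B \<subseteq> y"
    using A B y vertex_subspace subspace_ssum ssum_least by auto
  ultimately show ?thesis
    using card_hyperplanes[OF y] A by (simp add: card_Diff_subset)
qed

lemma dim_adjacent:
  assumes "y \<in> X" "z \<in> X" "y \<noteq> z" "subspace H" "H \<subseteq> y" "H \<subseteq> z" "dim H = D - 1"
  shows "y \<inter> z = H"
proof (rule eq_if_dim_le[symmetric])
  have s: "subspace (y \<inter> z)" using assms vertex_subspace subspace_inter by blast
  have "dim (y \<inter> z) < D"
  proof (rule ccontr)
    assume "\<not> dim (y \<inter> z) < D"
    then have "y \<inter> z = y" using s assms vertex_subspace vertex_dim by (intro eq_if_dim_le) auto
    then show False using vertex_eqI[of y z] assms by blast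
  qed
  then show "dim (y \<inter> z) \<le> dim H" using assms by simp
  show "subspace (y \<inter> z)" by fact
qed (use assms in auto)

text \<open>Vertices through \<open>H\<close> are the isotropic one-dimensional subspaces of the
  plane \<open>perp H\<close> modulo \<open>H\<close>. Apart from \<open>y\<close> itself they are
  spanned by \<open>w + scale a v\<close> for a unique \<open>a\<close>, and substituting
  \<open>s = c + a * d\<close> turns isotropy into the equation \<open>s ^ r + s = c\<close>, which
  has \<open>r\<close> solutions.\<close>

lemma card_other_on_line:
  assumes y: "y \<in> X" and H: "subspace H" "H \<subseteq> y" "dim H = D - 1"
  shows "card {z \<in> X. H \<subseteq> z \<and> z \<noteq> y} = r"
proof -
  have ys: "subspace y" "dim y = D" "perp y = y"
    using y vertex_subspace vertex_dim vertex_perp by auto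
  have "H \<noteq> y" using H(3) ys D_pos by auto
  then obtain v where v: "v \<in> y" "v \<notin> H" using H by blast
  have Hv: "H \<boxplus> span {v} = y"
    using v H ys dim_ssum_span[OF H(1) v(2)] D_pos span_minimal[of "{v}" y]
    by (intro eq_if_dim_le subspace_ssum ssum_least) auto
  have dP: "dim (perp H) = Suc D" using dim_perp[OF H(1)] H(3) D_pos by simp
  have yP: "y \<subseteq> perp H" using perp_antimono[OF H(2)] ys by simp
  then have "y \<noteq> perp H" using ys dP by auto
  then obtain w where w: "w \<in> perp H" "w \<notin> y" using yP by blast
  have yw: "y \<boxplus> span {w} = perp H"
    using w yP dim_ssum_span[OF ys(1) w(2)] dP ys span_minimal[of "{w}" "perp H"] subspace_perp
    by (intro eq_if_dim_le subspace_ssum ssum_least) auto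
  define c d where "c = h w w" and "d = h v w"
  \<comment> \<open>Otherwise \<open>w\<close> would be orthogonal to both \<open>H\<close> and
    \<open>v\<close>, hence to \<open>y\<close>, and so lie in \<open>y\<close>.\<close>
  have d: "d \<noteq> 0"
  proof
    assume "d = 0"
    then have "w \<in> perp {v}" using form_swap_zero by (simp add: perp_def d_def)
    then have "w \<in> perp (H \<boxplus> span {v})"
      using w(1) perp_ssum[OF H(1), of "span {v}"] perp_span[of "{v}"] by simp
    then show False using w(2) Hv ys by simp
  qed
  have vv: "h v v = 0" using v ys(3) unfolding perp_def by blast
  have form_eq: "h (w + scale a v) (w + scale a v) = (c + a * d) ^ r + a * d" for a
  proof -
    have "h w (w + scale a v) = (c + a * d) ^ r"
      using form_hermitian[of w "w + scale a v"] by (simp add: form_add form_scale c_def d_def)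
    moreover have "h v (w + scale a v) = d"
      using form_hermitian[of v "w + scale a v"] form_hermitian[of v w] vv
      by (simp add: form_add form_scale d_def)
    ultimately show ?thesis by (simp add: form_add form_scale)
  qed
  define S where "S = {a. h (w + scale a v) (w + scale a v) = 0}"
  have "card {s. s ^ r + s = c} = r"
  proof (rule card_fiber_eq[OF r_gt_1 card_field])
    fix s :: 'k
    \<comment> \<open>Every value of the trinomial is a value of the form on some vector, because
      \<open>a = (s - c) / d\<close> gives \<open>c + a * d = s\<close>.\<close>
    have "h (w + scale ((s - c) / d) v) (w + scale ((s - c) / d) v) = s ^ r + s - c"
      unfolding form_eq using d by simp
    then show "(s ^ r + s - c) ^ r = s ^ r + s - c"
      using form_hermitian[of "w + scale ((s - c) / d) v" "w + scale ((s - c) / d) v"] by simp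
  qed
  moreover have "bij_betw (\<lambda>a. c + a * d) S {s. s ^ r + s = c}"
    by (rule bij_betwI[where g = "\<lambda>s. (s - c) / d"])
      (use d in \<open>auto simp: S_def form_eq algebra_simps\<close>)
  ultimately have card_S: "card S = r" using bij_betw_same_card by metis
  let ?f = "\<lambda>a. H \<boxplus> span {w + scale a v}"
  have notH: "w + scale a v \<notin> y" for a
  proof
    assume "w + scale a v \<in> y"
    then have "(w + scale a v) - scale a v \<in> y" using v ys subspace_diff subspace_scale by blast
    then show False using w by simp
  qed
  have mem: "w + scale a v \<in> ?f a" "H \<subseteq> ?f a" for a
    using ssum_upper2[OF H(1), of "span {w + scale a v}"] span_base[of "w + scale a v" "{w + scale a v}"]
      ssum_upper1[of "span {w + scale a v}" H] by auto
  have "bij_betw ?f S {z \<in> X. H \<subseteq> z \<and> z \<noteq> y}"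
  proof (rule bij_betw_imageI)
    have X_f: "?f a \<in> X" if "a \<in> S" for a
    proof -
      let ?u = "w + scale a v"
      have u: "?u \<in> perp H" using w v yP subspace_perp subspace_add subspace_scale by blast
      have iso: "?u \<in> perp {?u}" using that by (simp add: S_def perp_def)
      have "perp (?f a) = perp H \<inter> perp {?u}"
        using perp_ssum[OF H(1), of "span {?u}"] perp_span[of "{?u}"] by simp
      moreover have "H \<subseteq> perp H" using H yP by blast
      moreover have "H \<subseteq> perp {?u}" using u subset_perp_swap[of "{?u}" H] by simp
      ultimately have "H \<subseteq> perp (?f a)" "span {?u} \<subseteq> perp (?f a)"
        using u iso span_minimal[of "{?u}" "perp (?f a)"] subspace_perp[of "?f a"] by auto
      then have "?f a \<subseteq> perp (?f a)" by (intro ssum_least subspace_perp)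
      moreover have "dim (?f a) = D"
        using dim_ssum_span[OF H(1), of ?u] notH[of a] H D_pos by auto
      moreover have "subspace (?f a)" using H(1) subspace_ssum by blast
      ultimately have "?f a = perp (?f a)"
        using dim_perp[of "?f a"] by (intro eq_if_dim_le) (auto simp: subspace_perp)
      then show ?thesis using \<open>subspace (?f a)\<close> vertex_iff by simp
    qed
    have no_v: "v \<notin> z" if "z \<in> X" "H \<subseteq> z" "z \<noteq> y" for z
    proof
      assume "v \<in> z"
      then have "y \<subseteq> z" unfolding Hv[symmetric]
        using that vertex_subspace span_minimal[of "{v}" z] by (intro ssum_least) auto
      then show False using vertex_eqI[OF y that(1)] that(3) by blast
    qed
    show "inj_on ?f S"
    proof (rule inj_onI, rule ccontr)
      fix a a' assume a: "a \<in> S" "a' \<in> S" "?f a = ?f a'" "a \<noteq> a'"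
      have s: "subspace (?f a)" using X_f a vertex_subspace by blast
      have "(w + scale a v) - (w + scale a' v) \<in> ?f a"
        using mem(1)[of a] mem(1)[of a'] unfolding a(3)[symmetric] by (rule subspace_diff[OF s])
      then have "scale (inverse (a - a')) (scale (a - a') v) \<in> ?f a"
        using subspace_scale[OF s] by (simp add: scale_left_diff_distrib)
      then have "v \<in> ?f a" using a(4) by simp
      moreover have "?f a \<noteq> y" using mem(1)[of a] notH by blast
      ultimately show False using no_v[OF X_f[OF a(1)] mem(2)] by blast
    qed
    show "?f ` S = {z \<in> X. H \<subseteq> z \<and> z \<noteq> y}"
    proof
      show "?f ` S \<subseteq> {z \<in> X. H \<subseteq> z \<and> z \<noteq> y}"
        using X_f mem notH by blast
      show "{z \<in> X. H \<subseteq> z \<and> z \<noteq> y} \<subseteq> ?f ` S"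
      proof clarify
        fix z assume z: "z \<in> X" "H \<subseteq> z" "z \<noteq> y"
        have zs: "subspace z" using z vertex_subspace by blast
        have "H \<noteq> z" using H(3) z vertex_dim D_pos by auto
        then obtain u where u: "u \<in> z" "u \<notin> H" using z by blast
        have "u \<notin> y" using dim_adjacent[OF z(1) y z(3) H(1) z(2) H(2,3)] u by blast
        have "z \<subseteq> perp H" using perp_antimono[OF z(2)] z vertex_perp by blast
        then have "u \<in> y \<boxplus> span {w}" using u yw by blast
        then obtain t k where t: "t \<in> y" "u = t + scale k w"
          unfolding ssum_def span_singleton by auto
        have k: "k \<noteq> 0" using t \<open>u \<notin> y\<close> by auto
        from t(1) obtain t' a where t': "t' \<in> H" "t = t' + scale a v"
          unfolding Hv[symmetric] ssum_def span_singleton by auto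
        \<comment> \<open>Removing the part in \<open>H\<close> and dividing by the coefficient of
          \<open>w\<close>, nonzero because \<open>u\<close> is outside \<open>y\<close>, gives the
          normalised spanning vector.\<close>
        have "scale (inverse k) (u - t') \<in> z"
          using u t' z zs subspace_scale subspace_diff by blast
        moreover have "scale (inverse k) (u - t') = w + scale (a / k) v"
          using t t' k by (simp add: scale_right_distrib field_simps)
        ultimately have wz: "w + scale (a / k) v \<in> z" by simp
        then have "a / k \<in> S" unfolding S_def using z(1) vertex_perp perp_def by blast
        moreover have "?f (a / k) \<subseteq> z"
          using wz z zs span_minimal[of "{w + scale (a / k) v}" z] by (intro ssum_least) auto
        then have "?f (a / k) = z" using vertex_eqI[OF X_f[OF \<open>a / k \<in> S\<close>] z(1)] by blast
        ultimately show "z \<in> ?f ` S" by blast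
      qed
    qed
  qed
  then show ?thesis using bij_betw_same_card card_S by fastforce
qed

text \<open>If \<open>x \<inter> z\<close> is not inside \<open>w\<close>, then \<open>z\<close> is
  the sum of \<open>z \<inter> w\<close> and \<open>x \<inter> z\<close>. Now
  \<open>x \<inter> w\<close> is orthogonal to the first summand within \<open>w\<close> and to the
  second within \<open>x\<close>, hence lies in \<open>z\<close>, and the trace loses exactly one
  dimension.\<close>

lemma upper_iff:
  assumes z: "z \<in> X" and w: "w \<in> X" and adj: "dim (z \<inter> w) = D - 1"
  shows "cov z w \<longleftrightarrow> \<not> x \<inter> z \<subseteq> w"
proof
  assume "cov z w"
  then have "dim (x \<inter> w) < dim (x \<inter> z)" unfolding cov_def by simp
  moreover have "dim (x \<inter> z) \<le> dim (x \<inter> w)" if "x \<inter> z \<subseteq> w" using that by (intro dim_subset) auto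
  ultimately show "\<not> x \<inter> z \<subseteq> w" by linarith
next
  assume n: "\<not> x \<inter> z \<subseteq> w"
  have s: "subspace (x \<inter> z)" "subspace (z \<inter> w)" "subspace (z \<inter> w \<boxplus> (x \<inter> z))"
    using z w subspace_x_Int vertex_subspace subspace_inter subspace_ssum by auto
  have sub: "z \<inter> w \<boxplus> (x \<inter> z) \<subseteq> z" using z vertex_subspace by (intro ssum_least) auto
  have "\<not> z \<inter> w \<boxplus> (x \<inter> z) \<subseteq> z \<inter> w" using n ssum_upper2[OF s(2), of "x \<inter> z"] by blast
  then have "z \<inter> w \<noteq> z \<inter> w \<boxplus> (x \<inter> z)" by blast
  then have "dim (z \<inter> w) < dim (z \<inter> w \<boxplus> (x \<inter> z))"
    using eq_if_dim_le[OF s(2,3) ssum_upper1[OF s(1)]] by linarith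
  then have d: "dim (z \<inter> w \<boxplus> (x \<inter> z)) = D"
    using adj dim_subset[OF sub] vertex_dim[OF z] by linarith
  then have z_eq: "z \<inter> w \<boxplus> (x \<inter> z) = z"
    using sub s z vertex_subspace vertex_dim by (intro eq_if_dim_le) auto
  have "x \<inter> w \<subseteq> perp (x \<inter> z)" using isotropic_subset_perp[OF x_vertex] by blast
  moreover have "x \<inter> w \<subseteq> perp (z \<inter> w)" using isotropic_subset_perp[OF w] by blast
  ultimately have "x \<inter> w \<subseteq> perp (z \<inter> w \<boxplus> (x \<inter> z))" using perp_ssum[OF s(2,1)] by blast
  then have "x \<inter> w \<subseteq> z" using z_eq vertex_perp[OF z] by simp
  then have "(z \<inter> w) \<inter> (x \<inter> z) = x \<inter> w" by blast
  then have "dim (x \<inter> z) = Suc (dim (x \<inter> w))"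
    using dim_ssum[OF s(2,1)] d adj D_pos by simp
  then show "cov z w" unfolding cov_iff_adjacent using z w adj by simp
qed

text \<open>Through each hyperplane of \<open>z\<close> pass \<open>r\<close> other vertices. All of
  them or none are upper covers, according to whether the hyperplane omits or contains
  \<open>x \<inter> z\<close>.\<close>

lemma card_upper:
  assumes z: "z \<in> X"
  shows "card {w. cov z w} = r * (gnum (r\<^sup>2) D - gnum (r\<^sup>2) (D - dim (x \<inter> z)))"
proof -
  define F where "F = {H. subspace H \<and> {0} \<subseteq> H \<and> H \<subseteq> z \<and> dim H = D - 1 \<and> \<not> x \<inter> z \<subseteq> H}"
  have zs: "subspace z" "0 \<in> z" using z vertex_subspace subspace_0 by auto
  have F: "card F = gnum (r\<^sup>2) D - gnum (r\<^sup>2) (D - dim (x \<inter> z))"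
  proof -
    have "{0} \<boxplus> (x \<inter> z) = x \<inter> z" by (auto simp: ssum_def)
    then show ?thesis
      unfolding F_def using card_hyperplanes_diff[OF z, of "{0}" "x \<inter> z"] zs subspace_x_Int[OF z] by simp
  qed
  have "{w. cov z w} = (\<Union>H\<in>F. {w \<in> X. H \<subseteq> w \<and> w \<noteq> z})"
  proof
    show "{w. cov z w} \<subseteq> (\<Union>H\<in>F. {w \<in> X. H \<subseteq> w \<and> w \<noteq> z})"
    proof clarify
      fix w assume c: "cov z w"
      then have w: "w \<in> X" "dim (z \<inter> w) = D - 1" "w \<noteq> z" unfolding cov_iff_adjacent by auto
      have "subspace (z \<inter> w)" using zs w vertex_subspace subspace_inter by blast
      then have "z \<inter> w \<in> F"
        unfolding F_def using w c upper_iff[OF z w(1,2)] subspace_0 by auto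
      then show "w \<in> (\<Union>H\<in>F. {w \<in> X. H \<subseteq> w \<and> w \<noteq> z})" using w by blast
    qed
    show "(\<Union>H\<in>F. {w \<in> X. H \<subseteq> w \<and> w \<noteq> z}) \<subseteq> {w. cov z w}"
    proof clarify
      fix H w assume H: "H \<in> F" and w: "w \<in> X" "H \<subseteq> w" "w \<noteq> z"
      have "z \<inter> w = H" using dim_adjacent[OF z w(1) _ _ _ w(2)] H w(3) unfolding F_def by blast
      then show "cov z w" using upper_iff[OF z w(1)] H unfolding F_def by blast
    qed
  qed
  also have "card \<dots> = (\<Sum>H\<in>F. card {w \<in> X. H \<subseteq> w \<and> w \<noteq> z})"
  proof (rule card_UN_disjoint)
    show "\<forall>H\<in>F. \<forall>H'\<in>F. H \<noteq> H' \<longrightarrow> {w \<in> X. H \<subseteq> w \<and> w \<noteq> z} \<inter> {w \<in> X. H' \<subseteq> w \<and> w \<noteq> z} = {}"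
    proof (intro ballI impI)
      fix H H' assume HH: "H \<in> F" "H' \<in> F" "H \<noteq> H'"
      have "H = H'" if "w \<in> X" "H \<subseteq> w" "H' \<subseteq> w" "w \<noteq> z" for w
        using dim_adjacent[OF z that(1), of H] dim_adjacent[OF z that(1), of H'] that HH
        unfolding F_def by auto
      then show "{w \<in> X. H \<subseteq> w \<and> w \<noteq> z} \<inter> {w \<in> X. H' \<subseteq> w \<and> w \<noteq> z} = {}" using HH(3) by blast
    qed
  qed auto
  also have "\<dots> = (\<Sum>H\<in>F. r)"
    by (rule sum.cong) (auto simp: F_def intro!: card_other_on_line z)
  finally show ?thesis using F by simp
qed

text \<open>No factor \<open>r\<close> appears: among the vertices through a hyperplane
  \<open>H\<close> of \<open>z\<close> containing \<open>z \<inter> y\<close>, only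
  \<open>proj H y\<close> is closer to \<open>y\<close>. Comparing \<open>w \<inter> y\<close> with
  \<open>perp H \<inter> y\<close> shows that \<open>H\<close> must contain
  \<open>z \<inter> y\<close>.\<close>

lemma card_upper_towards:
  assumes y: "y \<in> X" and z: "z \<in> X"
  shows "card {w. cov z w \<and> dim (w \<inter> y) = Suc (dim (z \<inter> y))} =
    gnum (r\<^sup>2) (D - dim (z \<inter> y)) - gnum (r\<^sup>2) (D - dim ((z \<inter> y) \<boxplus> (x \<inter> z)))"
proof -
  define F where "F = {H. subspace H \<and> z \<inter> y \<subseteq> H \<and> H \<subseteq> z \<and> dim H = D - 1 \<and> \<not> x \<inter> z \<subseteq> H}"
  define W where "W = {w. cov z w \<and> dim (w \<inter> y) = Suc (dim (z \<inter> y))}"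
  have sub: "subspace y" "subspace z" "subspace (z \<inter> y)"
    using y z vertex_subspace subspace_inter by auto
  have W_dest: "w \<inter> z \<in> F \<and> proj (w \<inter> z) y = w" if "w \<in> W" for w
  proof -
    have w: "w \<in> X" "dim (z \<inter> w) = D - 1" "cov z w" "dim (w \<inter> y) = Suc (dim (z \<inter> y))"
      using that unfolding W_def cov_iff_adjacent by auto
    define H where "H = w \<inter> z"
    have H: "subspace H" "dim H = D - 1" "H \<subseteq> w" "H \<subseteq> z"
      unfolding H_def using w sub vertex_subspace subspace_inter by (auto simp: Int_commute)
    have sHy: "subspace (H \<inter> y)" "subspace (perp H \<inter> y)" "subspace (w \<inter> y)"
      using H sub subspace_inter subspace_perp w vertex_subspace by auto
    have d: "dim (perp H \<inter> y) = Suc (dim (H \<inter> y))"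
      using dim_perp_Int_vertex[OF H(1) y] H(2) D_pos by simp
    have wP: "w \<inter> y \<subseteq> perp H \<inter> y" using isotropic_subset_perp[OF w(1), of w H] H by blast
    have "H \<inter> y = z \<inter> y"
      using dim_subset[OF wP] d w(4) H(4) sHy sub by (intro eq_if_dim_le) auto
    then have "w \<inter> y = perp H \<inter> y"
      using wP d w(4) sHy by (intro eq_if_dim_le) auto
    then have "proj H y \<subseteq> w"
      unfolding proj_def using H w vertex_subspace by (intro ssum_least) auto
    moreover have "proj H y \<in> X"
      using H isotropic_subset_perp[OF w(1)] y by (intro proj_vertex) auto
    ultimately have "proj H y = w" using w(1) vertex_eqI by blast
    moreover have "H \<in> F"
      using H w upper_iff[OF z w(1,2)] \<open>H \<inter> y = z \<inter> y\<close> unfolding F_def by blast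
    ultimately show ?thesis unfolding H_def by blast
  qed
  have F_dest: "proj H y \<in> W \<and> proj H y \<inter> z = H" if "H \<in> F" for H
  proof -
    have H: "subspace H" "z \<inter> y \<subseteq> H" "H \<subseteq> z" "dim H = D - 1" "\<not> x \<inter> z \<subseteq> H"
      using that unfolding F_def by auto
    have HP: "H \<subseteq> perp H" using isotropic_subset_perp[OF z H(3,3)] .
    define w where "w = proj H y"
    have w: "w \<in> X" unfolding w_def using proj_vertex[OF H(1) HP y] .
    have s: "subspace (perp H \<inter> y)" using sub subspace_inter subspace_perp by blast
    have Hw: "H \<subseteq> w" unfolding w_def proj_def using s by (rule ssum_upper1)
    have "H \<inter> y = z \<inter> y" using H by blast
    then have d: "dim (perp H \<inter> y) = Suc (dim (z \<inter> y))"
      using dim_perp_Int_vertex[OF H(1) y] H(4) D_pos by simp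
    have "perp H \<inter> y \<subseteq> w \<inter> y"
      unfolding w_def proj_def using ssum_upper2[OF H(1), of "perp H \<inter> y"] by blast
    moreover have "w \<inter> y \<subseteq> perp H \<inter> y" using isotropic_subset_perp[OF w, of w H] Hw by blast
    ultimately have dw: "dim (w \<inter> y) = Suc (dim (z \<inter> y))" using d by (metis antisym)
    then have "w \<noteq> z" by auto
    then have wz: "w \<inter> z = H" using dim_adjacent[OF w z _ H(1) Hw H(3,4)] by blast
    then have "cov z w" using upper_iff[OF z w] H by (auto simp: Int_commute)
    then show ?thesis using dw wz unfolding W_def w_def by blast
  qed
  have "bij_betw (\<lambda>w. w \<inter> z) W F"
    by (rule bij_betwI[where g = "\<lambda>H. proj H y"]) (use W_dest F_dest in auto)
  then have "card W = card F" by (rule bij_betw_same_card)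
  then show ?thesis
    unfolding W_def F_def
    using card_hyperplanes_diff[OF z sub(3) _ subspace_x_Int[OF z]] by simp
qed

end

section \<open>Counting paths\<close>

context dual_polar
begin

lemma cov_dest:
  assumes "cov y z"
  shows "y \<in> X" "z \<in> X" "below y z" "dim (x \<inter> y) = Suc (dim (x \<inter> z))" "x \<inter> z \<subseteq> x \<inter> y"
  using assms below_Int_subset unfolding cov_def by auto

lemma cov_cov_dest:
  assumes "cov y u" "cov u z"
  shows "below y z" "dim (x \<inter> y) = dim (x \<inter> z) + 2"
  using below_trans[OF cov_dest(1,2)[OF assms(1)] cov_dest(2)[OF assms(2)]]
    cov_dest(3,4)[OF assms(1)] cov_dest(3,4)[OF assms(2)] by auto

text \<open>An interval of length two has b + 1 middle elements; this factor becomes the denominator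
  of both coefficients.\<close>

lemma card_cov_cov:
  assumes y: "y \<in> X" and z: "z \<in> X"
  shows "card {u. cov y u \<and> cov u z} =
    (if below y z \<and> dim (x \<inter> y) = dim (x \<inter> z) + 2 then r\<^sup>2 + 1 else 0)"
proof (cases "below y z \<and> dim (x \<inter> y) = dim (x \<inter> z) + 2")
  case True
  then have "{u. cov y u \<and> cov u z} = {u. cov u z \<and> below y u}"
    using y unfolding cov_def by auto
  then show ?thesis using True card_interval[OF y z] gnum_2[of "r\<^sup>2"] by simp
next
  case False
  then have "{u. cov y u \<and> cov u z} = {}" using cov_cov_dest by blast
  then have "card {u. cov y u \<and> cov u z} = 0" by (simp only: card.empty)
  then show ?thesis unfolding if_not_P[OF False] .
qed

text \<open>Below \<open>w\<close> the order is an inverted subspace lattice, so a meet exists: the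
  projection of \<open>w\<close> belonging to the sum of the two traces.\<close>

lemma common_lower:
  assumes X: "y \<in> X" "z \<in> X" "w \<in> X" and le: "below y w" "below z w"
  obtains t where "t \<in> X" "below t y" "below t z" "x \<inter> t = (x \<inter> y) \<boxplus> (x \<inter> z)"
proof -
  define A where "A = (x \<inter> y) \<boxplus> (x \<inter> z)"
  have s: "subspace (x \<inter> y)" "subspace (x \<inter> z)" using X subspace_x_Int by auto
  have A: "subspace A" "A \<subseteq> x" "x \<inter> y \<subseteq> A" "x \<inter> z \<subseteq> A"
    unfolding A_def
    using s subspace_ssum ssum_least[OF x_subspace] ssum_upper1[OF s(2)] ssum_upper2[OF s(1)] by auto
  have xw: "x \<inter> w \<subseteq> A" using below_Int_subset[OF X(1,3) le(1)] A(3) by (rule order_trans)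
  note p = below_proj[OF A(1,2) X(3) xw] x_Int_proj[OF A(1,2) X(3) xw]
  have "below (proj A w) y" "below (proj A w) z"
    using below_of_below[OF p(1) X(1,3) p(2) le(1)] below_of_below[OF p(1) X(2,3) p(2) le(2)] p(3) A
    by auto
  then show ?thesis using that p by (simp add: A_def)
qed

lemma common_lower_Int:
  assumes X: "y \<in> X" "z \<in> X" and t: "cov t y" "below t z" and n: "\<not> x \<inter> z \<subseteq> x \<inter> y"
  shows "x \<inter> t = (x \<inter> y) \<boxplus> (x \<inter> z)"
proof -
  note t' = cov_dest[OF t(1)]
  have s: "subspace (x \<inter> y)" "subspace (x \<inter> z)" "subspace (x \<inter> t)"
    using X t' subspace_x_Int by auto
  have sub: "(x \<inter> y) \<boxplus> (x \<inter> z) \<subseteq> x \<inter> t"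
    using t' below_Int_subset[OF t'(1) X(2) t(2)] by (intro ssum_least s)
  have "(x \<inter> y) \<boxplus> (x \<inter> z) \<noteq> x \<inter> y" using n ssum_upper2[OF s(1), of "x \<inter> z"] by blast
  then have "dim (x \<inter> y) < dim ((x \<inter> y) \<boxplus> (x \<inter> z))"
    using eq_if_dim_le[OF s(1) subspace_ssum[OF s(1,2)] ssum_upper1[OF s(2)]] by (metis not_le)
  then show ?thesis using t'(4) sub s subspace_ssum by (intro eq_if_dim_le[symmetric]) auto
qed

text \<open>Hence alpha is at most 1 as soon as the trace of \<open>z\<close> is not contained in
  that of \<open>y\<close>.\<close>

lemma common_lower_unique:
  assumes "y \<in> X" "z \<in> X" "\<not> x \<inter> z \<subseteq> x \<inter> y"
    and "cov t y" "below t z" "cov t' y" "below t' z"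
  shows "t = t'"
proof -
  have "x \<inter> t = x \<inter> t'"
    using common_lower_Int[OF assms(1,2,4,5,3)] common_lower_Int[OF assms(1,2,6,7,3)] by simp
  then show ?thesis
    using below_unique[OF cov_dest(1)[OF assms(4)] cov_dest(1)[OF assms(6)] assms(1)]
      cov_dest(3)[OF assms(4)] cov_dest(3)[OF assms(6)] by blast
qed

text \<open>In terms of codimensions this is the triangle inequality for the way from
  \<open>x\<close> to \<open>w\<close> through \<open>y\<close>; equality is the case
  \<open>below y w\<close>.\<close>

lemma dim_Int_le:
  assumes "y \<in> X" "w \<in> X"
  shows "dim (w \<inter> y) + dim (x \<inter> y) \<le> D + dim (x \<inter> w)"
proof -
  have s: "subspace (w \<inter> y)" "subspace (x \<inter> y)"
    using assms vertex_subspace subspace_inter subspace_x_Int by auto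
  have "(w \<inter> y) \<boxplus> (x \<inter> y) \<subseteq> y" using assms vertex_subspace by (intro ssum_least) auto
  then have "dim ((w \<inter> y) \<boxplus> (x \<inter> y)) \<le> D" using dim_subset vertex_dim[OF assms(1)] by metis
  moreover have "dim ((w \<inter> y) \<inter> (x \<inter> y)) \<le> dim (x \<inter> w)" by (intro dim_subset) auto
  ultimately show ?thesis using dim_ssum[OF s] by linarith
qed

text \<open>
  Every upper cover of \<open>z\<close> above \<open>y\<close> is one step closer to \<open>y\<close> than \<open>z\<close> is, so
  \<open>card_upper_towards\<close> counts them once \<open>dim (z \<inter> y)\<close> is known; an upper cover of \<open>z\<close> towards \<open>y\<close>
  exists because \<open>x \<inter> z\<close> is not contained in \<open>y\<close>, and it bounds that dimension from above.
\<close>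

lemma card_common_upper:
  assumes X: "y \<in> X" "z \<in> X" and t: "cov t y" "below t z" and n: "\<not> x \<inter> z \<subseteq> x \<inter> y"
  shows "card {w. cov z w \<and> below y w} = (r\<^sup>2) ^ (dim (x \<inter> t) - dim (x \<inter> z))"
proof -
  \<comment> \<open>This is the distance from \<open>t\<close> to \<open>z\<close>, so the exponent
    is known before the dimension of \<open>z \<inter> y\<close> is.\<close>
  define e where "e = dim (x \<inter> t) - dim (x \<inter> z)"
  note t' = cov_dest[OF t(1)]
  have xzt: "x \<inter> z \<subseteq> x \<inter> t" using below_Int_subset[OF t'(1) X(2) t(2)] .
  then have e: "dim (x \<inter> t) = dim (x \<inter> z) + e" using dim_subset by (simp add: e_def)
  have s: "subspace (x \<inter> y)" "subspace (x \<inter> z)" "subspace t" "subspace y" "subspace z"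
    "subspace (z \<inter> y)" "subspace (t \<inter> y)" "subspace (t \<inter> z)"
    using X t' subspace_x_Int vertex_subspace subspace_inter by auto
  have s': "subspace ((z \<inter> y) \<boxplus> (x \<inter> z))" using s subspace_ssum by blast
  have pos: "0 < dim (x \<inter> z)"
  proof (rule ccontr)
    assume "\<not> 0 < dim (x \<inter> z)"
    then have "x \<inter> z \<subseteq> {0}" by simp
    then show False using n subspace_0[OF s(1)] by blast
  qed
  \<comment> \<open>The way from \<open>y\<close> through \<open>t\<close> to \<open>z\<close>
    bounds the distance from \<open>y\<close> to \<open>z\<close> by \<open>e + 1\<close>.\<close>
  have Suc_lower: "D \<le> dim (z \<inter> y) + e + 1"
  proof -
    have "dim (t \<inter> y) + 1 = D" using t(1) D_pos unfolding cov_iff_adjacent by simp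
    moreover have "dim (t \<inter> z) + e = D" using below_dim[OF t'(1) X(2) t(2)] e by simp
    moreover have "dim ((t \<inter> y) \<boxplus> (t \<inter> z)) \<le> D"
      using ssum_least[OF s(3), of "t \<inter> y" "t \<inter> z"] vertex_dim[OF t'(1)] dim_subset by fastforce
    moreover have "dim ((t \<inter> y) \<inter> (t \<inter> z)) \<le> dim (z \<inter> y)" by (intro dim_subset) auto
    ultimately show ?thesis using dim_ssum[OF s(7,8)] by linarith
  qed
  have "dim (z \<inter> y) < dim ((z \<inter> y) \<boxplus> (x \<inter> z))"
  proof (rule ccontr)
    assume "\<not> dim (z \<inter> y) < dim ((z \<inter> y) \<boxplus> (x \<inter> z))"
    then have "z \<inter> y = (z \<inter> y) \<boxplus> (x \<inter> z)"
      using s s' ssum_upper1[OF s(2)] by (intro eq_if_dim_le) auto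
    then show False using n ssum_upper2[OF s(6), of "x \<inter> z"] by blast
  qed
  moreover have "dim ((z \<inter> y) \<boxplus> (x \<inter> z)) \<le> D"
    using ssum_least[OF s(5), of "z \<inter> y" "x \<inter> z"] vertex_dim[OF X(2)] dim_subset by fastforce
  ultimately have "D - dim ((z \<inter> y) \<boxplus> (x \<inter> z)) < D - dim (z \<inter> y)" by linarith
  then obtain k where "D - dim (z \<inter> y) = Suc (D - dim ((z \<inter> y) \<boxplus> (x \<inter> z)) + k)"
    using less_imp_Suc_add by blast
  then have "gnum (r\<^sup>2) (D - dim ((z \<inter> y) \<boxplus> (x \<inter> z))) < gnum (r\<^sup>2) (D - dim (z \<inter> y))"
    using gnum_add[of "r\<^sup>2" "D - dim ((z \<inter> y) \<boxplus> (x \<inter> z))" "Suc k"] gnum_Suc[of "r\<^sup>2" k] r_gt_1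
    by simp
  then have "card {w. cov z w \<and> dim (w \<inter> y) = Suc (dim (z \<inter> y))} \<noteq> 0"
    using card_upper_towards[OF X] by simp
  then have "{w. cov z w \<and> dim (w \<inter> y) = Suc (dim (z \<inter> y))} \<noteq> {}"
    by (rule contrapos_nn) (simp only: card.empty)
  then obtain w where w: "cov z w" "dim (w \<inter> y) = Suc (dim (z \<inter> y))" by blast
  \<comment> \<open>Conversely, \<open>w\<close> is \<open>e\<close> levels above \<open>y\<close>,
    hence at distance at least \<open>e\<close> from it, and \<open>z\<close> is one step farther
    from \<open>y\<close> than \<open>w\<close>.\<close>
  have d: "dim (z \<inter> y) + e + 1 = D"
    using dim_Int_le[OF X(1) cov_dest(2)[OF w(1)]] w(2) cov_dest(4)[OF w(1)] t'(4) e Suc_lower by linarith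
  have sets: "{w. cov z w \<and> below y w} = {w. cov z w \<and> dim (w \<inter> y) = Suc (dim (z \<inter> y))}"
  proof -
    have "below y w \<longleftrightarrow> dim (w \<inter> y) = Suc (dim (z \<inter> y))" if c: "cov z w" for w
    proof -
      note w' = cov_dest[OF c]
      have "below y w \<longleftrightarrow> dim (y \<inter> w) + dim (x \<inter> y) = D + dim (x \<inter> w)"
        using below_dim[OF X(1) w'(2)] belowI_dim[OF X(1) w'(2)] by auto
      also have "\<dots> \<longleftrightarrow> dim (w \<inter> y) = Suc (dim (z \<inter> y))"
        using w'(4) t'(4) e d by (auto simp: Int_commute)
      finally show ?thesis .
    qed
    then show ?thesis by blast
  qed
  \<comment> \<open>The part of \<open>x \<inter> z\<close> inside \<open>y\<close> has codimension
    one in it, so the sum is only one dimension larger than \<open>z \<inter> y\<close>. The count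
    is then a difference of consecutive Gaussian numbers, which is a power of b.\<close>
  have "dim ((z \<inter> y) \<boxplus> (x \<inter> z)) + e = D"
  proof -
    have "(z \<inter> y) \<inter> (x \<inter> z) = (x \<inter> y) \<inter> (x \<inter> z)" by blast
    then show ?thesis
      using dim_ssum[OF s(6,2)] dim_ssum[OF s(1,2)] common_lower_Int[OF assms] t'(4) e d pos by simp
  qed
  then have "D - dim ((z \<inter> y) \<boxplus> (x \<inter> z)) = e" "D - dim (z \<inter> y) = Suc e" using d by auto
  moreover have "gnum (r\<^sup>2) (Suc e) = gnum (r\<^sup>2) e + (r\<^sup>2) ^ e" by (simp add: gnum_def)
  ultimately show ?thesis
    using card_upper_towards[OF X] sets unfolding e_def[symmetric] by simp
qed

text \<open>Distinct vertices with equal traces have no common upper bound, by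
  \<open>below_unique\<close>. Otherwise a common lower cover is unique and yields b upper ones,
  since here the exponent in \<open>card_common_upper\<close> is 1; and a common upper cover would
  force a common lower one.\<close>

lemma card_common_upper_same:
  assumes u: "u \<in> X" and y: "y \<in> X" and eq: "dim (x \<inter> u) = dim (x \<inter> y)" and ne: "u \<noteq> y"
  shows "card {w. cov u w \<and> cov y w} =
    (if x \<inter> u = x \<inter> y then 0 else r\<^sup>2 * card {t. cov t u \<and> cov t y})"
proof (cases "x \<inter> u = x \<inter> y")
  case True
  then have False if "cov u w" "cov y w" for w
    using below_unique[OF u y cov_dest(2)[OF that(1)]] cov_dest(3)[OF that(1)] cov_dest(3)[OF that(2)] ne
    by blast
  then have "{w. cov u w \<and> cov y w} = {}" by blast
  then show ?thesis using True by simp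
next
  case False
  have s: "subspace (x \<inter> u)" "subspace (x \<inter> y)" using u y subspace_x_Int by auto
  have n: "\<not> x \<inter> u \<subseteq> x \<inter> y" using eq_if_dim_le[OF s] eq False by auto
  have lower: "cov t u \<and> cov t y \<longleftrightarrow> cov t y \<and> below t u" for t
    unfolding cov_def using eq u by auto
  have upper: "cov u w \<and> cov y w \<longleftrightarrow> cov u w \<and> below y w" for w
    unfolding cov_def using eq y by auto
  show ?thesis
  proof (cases "\<exists>t. cov t y \<and> below t u")
    case True
    then obtain t where t: "cov t y" "below t u" by blast
    have "{t. cov t u \<and> cov t y} = {t}"
      using lower t common_lower_unique[OF y u n _ _ t] by blast
    moreover have "dim (x \<inter> t) - dim (x \<inter> u) = 1" using cov_dest[OF t(1)] eq by simp
    ultimately show ?thesis using card_common_upper[OF y u t n] upper False by simp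
  next
    case none: False
    have "{w. cov u w \<and> cov y w} = {}"
    proof (rule ccontr)
      assume "{w. cov u w \<and> cov y w} \<noteq> {}"
      then obtain w where w: "cov u w" "cov y w" by blast
      note wu = cov_dest[OF w(1)] and wy = cov_dest[OF w(2)]
      obtain t where t: "t \<in> X" "below t y" "below t u" "x \<inter> t = (x \<inter> y) \<boxplus> (x \<inter> u)"
        using common_lower[OF y u wu(2) wy(3) wu(3)] .
      have si: "subspace ((x \<inter> y) \<inter> (x \<inter> u))" using s subspace_inter by blast
      have "dim ((x \<inter> y) \<inter> (x \<inter> u)) < dim (x \<inter> u)"
        using eq_if_dim_le[OF si s(1)] n by (cases "dim (x \<inter> u) \<le> dim ((x \<inter> y) \<inter> (x \<inter> u))") auto
      moreover have "dim (x \<inter> w) \<le> dim ((x \<inter> y) \<inter> (x \<inter> u))"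
        using wu(5) wy(5) by (intro dim_subset) auto
      \<comment> \<open>Both traces contain \<open>x \<inter> w\<close> with codimension one and
        differ, so they meet in exactly that dimension. The meet \<open>t\<close> is therefore a
        common lower cover.\<close>
      ultimately have "dim ((x \<inter> y) \<boxplus> (x \<inter> u)) = Suc (dim (x \<inter> y))"
        using dim_ssum[OF s(2,1)] wu(4) wy(4) by linarith
      then show False using none t y unfolding cov_def by auto
    qed
    moreover have "{t. cov t u \<and> cov t y} = {}" using none lower by blast
    ultimately show ?thesis by (simp only: card.empty mult_0_right if_cancel)
  qed
qed

text \<open>A vertex above both \<open>y\<close> and \<open>z\<close> forces \<open>cov y z\<close>
  if the trace of \<open>z\<close> lies in that of \<open>y\<close>, and otherwise a meet that is
  covered by \<open>y\<close>. In the latter case the meet is two levels below \<open>z\<close>,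
  whence the exponent 2.\<close>

lemma card_upper_above:
  assumes y: "y \<in> X" and z: "z \<in> X" and d: "dim (x \<inter> y) = Suc (dim (x \<inter> z))"
  shows "card {w. cov z w \<and> below y w} =
    (if cov y z then card {w. cov z w}
     else if x \<inter> z \<subseteq> x \<inter> y then 0
     else (r\<^sup>2)\<^sup>2 * card {t. cov t y \<and> below t z})"
proof -
  consider "cov y z" | "\<not> cov y z" "x \<inter> z \<subseteq> x \<inter> y"
    | "\<not> x \<inter> z \<subseteq> x \<inter> y" "\<exists>t. cov t y \<and> below t z"
    | "\<not> x \<inter> z \<subseteq> x \<inter> y" "\<not> (\<exists>t. cov t y \<and> below t z)" by blast
  then show ?thesis
  proof cases
    case 1
    have "below y w" if "cov z w" for w
      using below_trans[OF y z cov_dest(2)[OF that]] cov_dest(3)[OF 1] cov_dest(3)[OF that] by blast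
    then have "{w. cov z w \<and> below y w} = {w. cov z w}" by blast
    then show ?thesis using 1 by simp
  next
    case 2
    have "cov y z" if "cov z w" "below y w" for w
      using below_of_below[OF y z cov_dest(2)[OF that(1)] that(2) cov_dest(3)[OF that(1)] 2(2)] y z d
      unfolding cov_def by simp
    then have "{w. cov z w \<and> below y w} = {}" using 2(1) by blast
    then show ?thesis using 2 by simp
  next
    case 3
    then obtain t where t: "cov t y" "below t z" by blast
    have "{t. cov t y \<and> below t z} = {t}"
      using t common_lower_unique[OF y z 3(1) _ _ t] by blast
    moreover have "dim (x \<inter> t) - dim (x \<inter> z) = 2" using cov_dest[OF t(1)] d by simp
    moreover have "\<not> cov y z" using 3(1) cov_dest(5)[of y z] by blast
    ultimately show ?thesis using card_common_upper[OF y z t 3(1)] 3 by simp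
  next
    case 4
    have s: "subspace (x \<inter> z)" "subspace (x \<inter> y)" using z y subspace_x_Int by auto
    have "{w. cov z w \<and> below y w} = {}"
    proof (rule ccontr)
      assume "{w. cov z w \<and> below y w} \<noteq> {}"
      then obtain w where w: "cov z w" "below y w" by blast
      note wz = cov_dest[OF w(1)]
      obtain t where t: "t \<in> X" "below t y" "below t z" "x \<inter> t = (x \<inter> y) \<boxplus> (x \<inter> z)"
        using common_lower[OF y z wz(2) w(2) wz(3)] .
      have si: "subspace ((x \<inter> y) \<inter> (x \<inter> z))" using s subspace_inter by blast
      have "dim ((x \<inter> y) \<inter> (x \<inter> z)) < dim (x \<inter> z)"
        using eq_if_dim_le[OF si s(1)] 4(1) by (cases "dim (x \<inter> z) \<le> dim ((x \<inter> y) \<inter> (x \<inter> z))") auto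
      moreover have "dim (x \<inter> w) \<le> dim ((x \<inter> y) \<inter> (x \<inter> z))"
        using wz(5) below_Int_subset[OF y wz(2) w(2)] by (intro dim_subset) auto
      ultimately have "dim ((x \<inter> y) \<boxplus> (x \<inter> z)) = Suc (dim (x \<inter> y))"
        using dim_ssum[OF s(2,1)] wz(4) by linarith
      then show False using 4 t y unfolding cov_def by auto
    qed
    moreover have "\<not> cov y z" using 4(1) cov_dest(5)[of y z] by blast
    moreover have "{t. cov t y \<and> below t z} = {}" using 4(2) by blast
    ultimately show ?thesis by (simp only: card.empty mult_0_right if_cancel if_False)
  qed
qed

text \<open>At most one of the b + 1 vertices between \<open>t\<close> and \<open>z\<close> has the
  trace of \<open>y\<close>. It exists exactly if \<open>x \<inter> z\<close> is contained in
  \<open>x \<inter> y\<close>, and is then \<open>proj (x \<inter> y) z\<close>. It is left out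
  because in the path count it gives the term for \<open>u = y\<close> or nothing.\<close>

lemma card_between_off:
  assumes y: "y \<in> X" and z: "z \<in> X" and d: "dim (x \<inter> y) = Suc (dim (x \<inter> z))"
    and t: "cov t y" "below t z"
  shows "card {u. cov t u \<and> cov u z \<and> x \<inter> u \<noteq> x \<inter> y} =
    (if x \<inter> z \<subseteq> x \<inter> y then r\<^sup>2 else r\<^sup>2 + 1)"
proof -
  note t' = cov_dest[OF t(1)]
  have c: "card {u. cov t u \<and> cov u z} = r\<^sup>2 + 1"
    using card_cov_cov[OF t'(1) z] t t'(4) d by simp
  show ?thesis
  proof (cases "x \<inter> z \<subseteq> x \<inter> y")
    case True
    define u where "u = proj (x \<inter> y) z"
    note p = below_proj[OF subspace_x_Int[OF y] Int_lower1 z True]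
      x_Int_proj[OF subspace_x_Int[OF y] Int_lower1 z True]
    have "below t u"
      unfolding u_def using below_of_below[OF t'(1) p(1) z t(2) p(2)] t'(5) p(3) by simp
    then have u: "cov t u" "cov u z" "x \<inter> u = x \<inter> y"
      using p t'(1,4) d z unfolding cov_def u_def by auto
    have "u' = u" if "cov u' z" "x \<inter> u' = x \<inter> y" for u'
      using below_unique[OF cov_dest(1)[OF that(1)] cov_dest(1)[OF u(2)] z
          cov_dest(3)[OF that(1)] cov_dest(3)[OF u(2)]] that(2) u(3) by simp
    then have "{u. cov t u \<and> cov u z \<and> x \<inter> u \<noteq> x \<inter> y} = {u. cov t u \<and> cov u z} - {u}"
      using u(3) by blast
    then show ?thesis using c u True by (simp add: card_Diff_singleton)
  next
    case False
    then have "{u. cov t u \<and> cov u z \<and> x \<inter> u \<noteq> x \<inter> y} = {u. cov t u \<and> cov u z}"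
      using cov_dest(5) by blast
    then show ?thesis using c False by simp
  qed
qed

text \<open>The term \<open>u = y\<close> is split off and other \<open>u\<close> with the trace of
  \<open>y\<close> contribute nothing. For the rest, common upper covers are traded for common lower
  covers \<open>t\<close>; after exchanging the sums each \<open>t\<close> contributes a number that
  does not depend on it.\<close>

lemma sum_common_upper:
  assumes y: "y \<in> X" and z: "z \<in> X" and d: "dim (x \<inter> y) = Suc (dim (x \<inter> z))"
  shows "(\<Sum>u | cov u z. card {w. cov u w \<and> cov y w}) =
    (if cov y z then card {w. cov y w} else 0) +
    r\<^sup>2 * (card {t. cov t y \<and> below t z} * (if x \<inter> z \<subseteq> x \<inter> y then r\<^sup>2 else r\<^sup>2 + 1))"
proof -
  define T where "T = {t. cov t y \<and> below t z}"
  let ?c = "\<lambda>u. card {w. cov u w \<and> cov y w}"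
  let ?U = "{u. cov u z \<and> x \<inter> u \<noteq> x \<inter> y}"
  have same: "?c u = (if u = y then card {w. cov y w} else 0) +
      (if x \<inter> u \<noteq> x \<inter> y then r\<^sup>2 * card {t. cov t u \<and> cov t y} else 0)" if "cov u z" for u
    using card_common_upper_same[OF cov_dest(1)[OF that] y] cov_dest(4)[OF that] d by auto
  have "(\<Sum>u | cov u z. ?c u) = (\<Sum>u | cov u z. (if u = y then card {w. cov y w} else 0)) +
      (\<Sum>u | cov u z. if x \<inter> u \<noteq> x \<inter> y then r\<^sup>2 * card {t. cov t u \<and> cov t y} else 0)"
    using same by (simp add: sum.distrib)
  also have "(\<Sum>u | cov u z. (if u = y then card {w. cov y w} else 0)) =
      (if cov y z then card {w. cov y w} else 0)" by simp
  also have "(\<Sum>u | cov u z. if x \<inter> u \<noteq> x \<inter> y then r\<^sup>2 * card {t. cov t u \<and> cov t y} else 0) =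
      (\<Sum>u\<in>?U. r\<^sup>2 * card {t. cov t u \<and> cov t y})"
    by (intro sum.mono_neutral_cong_right) auto
  also have "\<dots> = r\<^sup>2 * (\<Sum>u\<in>?U. \<Sum>t\<in>T. if cov t u then 1 else 0)"
  proof -
    have "card {t. cov t u \<and> cov t y} = (\<Sum>t\<in>T. if cov t u then 1 else 0)" if "u \<in> ?U" for u
    proof -
      have "{t. cov t u \<and> cov t y} = {t \<in> T. cov t u}"
      proof -
        have "below t z" if t: "cov t u" for t
          using below_trans[OF cov_dest(1,2)[OF t] z cov_dest(3)[OF t]] \<open>u \<in> ?U\<close> cov_dest(3) by blast
        then show ?thesis unfolding T_def by blast
      qed
      then show ?thesis by (simp add: sum.If_cases Int_def)
    qed
    then show ?thesis by (simp add: sum_distrib_left)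
  qed
  also have "(\<Sum>u\<in>?U. \<Sum>t\<in>T. if cov t u then 1 else 0) = (\<Sum>t\<in>T. \<Sum>u\<in>?U. if cov t u then 1 else 0)"
    by (rule sum.swap)
  also have "\<dots> = (\<Sum>t\<in>T. (if x \<inter> z \<subseteq> x \<inter> y then r\<^sup>2 else r\<^sup>2 + 1))"
  proof (rule sum.cong)
    fix t assume "t \<in> T"
    then have t: "cov t y" "below t z" unfolding T_def by auto
    have "(\<Sum>u\<in>?U. if cov t u then 1 else 0) = card {u. cov t u \<and> cov u z \<and> x \<inter> u \<noteq> x \<inter> y}"
      by (simp add: sum.If_cases Int_def conj_ac)
    then show "(\<Sum>u\<in>?U. if cov t u then 1 else 0) = (if x \<inter> z \<subseteq> x \<inter> y then r\<^sup>2 else r\<^sup>2 + 1)"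
      using card_between_off[OF y z d t] by simp
  qed simp
  finally show ?thesis unfolding T_def by simp
qed

text \<open>If \<open>cov y z\<close> fails, both sides are b^3 alpha or b^2 (b+1) alpha, according
  to whether \<open>x \<inter> z\<close> lies in \<open>x \<inter> y\<close>. If it holds, the alpha
  terms agree and the upper covers of \<open>y\<close> and of \<open>z\<close> remain to be
  compared.\<close>

lemma counting_identity:
  assumes y: "y \<in> X" and z: "z \<in> X" and d: "dim (x \<inter> y) = Suc (dim (x \<inter> z))"
  shows "r\<^sup>2 * (\<Sum>u | cov u z. card {w. cov u w \<and> cov y w}) =
    (r\<^sup>2) ^ 3 * card {t. cov t y \<and> below t z} + card {w. cov z w \<and> below y w} +
    (if cov y z then r * (r\<^sup>2) ^ D else 0)"
proof (cases "cov y z")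
  case True
  define b where "b = r\<^sup>2"
  define m where "m = D - dim (x \<inter> y)"
  have "dim (x \<inter> y) \<le> D" using dim_subset[of "x \<inter> y" x] vertex_dim[OF x_vertex] by simp
  then have m: "D = m + dim (x \<inter> y)" "D - dim (x \<inter> z) = Suc m" "D = Suc m + dim (x \<inter> z)"
    using d by (auto simp: m_def)
  have le: "gnum b m \<le> gnum b D" "gnum b (Suc m) \<le> gnum b D"
    by (intro gnum_mono; use m in linarith)+
  \<comment> \<open>Both sides are the Gaussian number of \<open>D + 1\<close>, with its lowest or
    its highest term split off.\<close>
  have "1 + b * gnum b D = gnum b D + b ^ D" using gnum_Suc[of b D] by (simp add: gnum_def)
  then have "b * gnum b D - b * gnum b m = (gnum b D - gnum b (Suc m)) + b ^ D"
    using gnum_Suc[of b m] le by linarith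
  then have diff: "b * (gnum b D - gnum b m) = (gnum b D - gnum b (Suc m)) + b ^ D"
    by (simp only: diff_mult_distrib2)
  have upper: "card {w. cov y w} = r * (gnum b D - gnum b m)"
    "card {w. cov z w} = r * (gnum b D - gnum b (Suc m))"
    using card_upper[OF y] card_upper[OF z] unfolding m(2) by (simp_all only: b_def m_def)
  have "b * card {w. cov y w} = card {w. cov z w} + r * b ^ D"
    unfolding upper mult.left_commute[of b r] diff by (rule distrib_left)
  moreover have "card {w. cov z w \<and> below y w} = card {w. cov z w}"
    unfolding card_upper_above[OF assms] if_P[OF True] ..
  moreover have "(\<Sum>u | cov u z. card {w. cov u w \<and> cov y w}) =
      card {w. cov y w} + b * (card {t. cov t y \<and> below t z} * b)"
    unfolding sum_common_upper[OF assms] if_P[OF True] if_P[OF cov_dest(5)[OF True]] b_def ..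
  ultimately show ?thesis
    unfolding if_P[OF True] b_def[symmetric] by (simp only: power3_eq_cube distrib_left mult_ac add_ac)
next
  case False
  then show ?thesis
    using sum_common_upper[OF assms] card_upper_above[OF assms]
    by (simp add: algebra_simps power2_eq_square power3_eq_cube)
qed

end

section \<open>Matrices\<close>

lemma det_tridiagonal_nonzero:
  fixes b n :: nat
  assumes b: "b > 0" and n: "n > 0"
  defines "em \<equiv> - ((of_nat b)\<^sup>2 / (of_nat b + 1) :: complex)"
    and "ep \<equiv> - (1 / (of_nat b * (of_nat b + 1)) :: complex)"
  defines "A \<equiv> mat n n (\<lambda>(i, j). if i = j then 1 else if i = Suc j then em else if j = Suc i then ep else 0)"
  shows "det A \<noteq> 0"
proof
  assume "det A = 0"
  have A: "A \<in> carrier_mat n n" by (simp add: A_def)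
  obtain v where v: "v \<in> carrier_vec n" "v \<noteq> 0\<^sub>v n" "A *\<^sub>v v = 0\<^sub>v n"
    using det_0_iff_vec_prod_zero_field[OF A] \<open>det A = 0\<close> by blast
  \<comment> \<open>Extending the kernel vector by 0 makes the last row an instance of the same
    recurrence. The value at \<open>n\<close> then serves as the boundary condition that annihilates
    \<open>g 0\<close>.\<close>
  define g where "g k = (if k < n then v $ k else 0)" for k
  let ?b = "of_nat b :: complex"
  have b0: "?b \<noteq> 0" "?b + 1 \<noteq> 0"
    using b by (simp, metis of_nat_1 of_nat_add of_nat_eq_0_iff add_is_0 one_neq_zero)
  have row: "(if i = 0 then 0 else em * g (i - 1)) + g i + ep * g (Suc i) = 0" if i: "i < n" for i
  proof -
    have "0 = (A *\<^sub>v v) $ i" using v(3) i by simp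
    also have "\<dots> = (\<Sum>j = 0..<n. A $$ (i, j) * g j)"
      using A v(1) i by (auto simp: mult_mat_vec_def scalar_prod_def g_def intro!: sum.cong)
    also have "\<dots> = (\<Sum>j = 0..<n. (if j = i then g j else 0) +
        (if j = i - 1 then (if i = 0 then 0 else em * g j) else 0) + (if j = Suc i then ep * g j else 0))"
      using i by (intro sum.cong) (auto simp: A_def)
    also have "\<dots> = g i + (if i = 0 then 0 else em * g (i - 1)) + (if Suc i < n then ep * g (Suc i) else 0)"
      using i by (simp add: sum.distrib sum.delta)
    also have "(if Suc i < n then ep * g (Suc i) else 0) = ep * g (Suc i)" by (simp add: g_def)
    finally show ?thesis by (simp add: add.commute add.left_commute)
  qed
  have rec: "g (Suc i) = ?b * (?b + 1) * g i - (if i = 0 then 0 else ?b ^ 3 * g (i - 1))" if "i < n" for i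
  proof -
    \<comment> \<open>This factor normalises the coefficient of \<open>g (Suc i)\<close> to
      1.\<close>
    have "0 = - (?b * (?b + 1)) * ((if i = 0 then 0 else em * g (i - 1)) + g i + ep * g (Suc i))"
      using row[OF that] by simp
    also have "\<dots> = (if i = 0 then 0 else ?b ^ 3 * g (i - 1)) - ?b * (?b + 1) * g i + g (Suc i)"
    proof -
      have "?b * (?b + 1) * em = - (?b ^ 3)"
        using b0(2) by (simp add: em_def power2_eq_square power3_eq_cube)
      moreover have "?b * (?b + 1) * ep = - 1" using b0 by (simp add: ep_def)
      moreover have "- (?b * (?b + 1)) * (e + g i + ep * g (Suc i)) =
          - (?b * (?b + 1) * e) - ?b * (?b + 1) * g i - (?b * (?b + 1) * ep) * g (Suc i)" for e
        by (simp add: algebra_simps)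
      moreover have "?b * (?b + 1) * (em * g (i - 1)) = (?b * (?b + 1) * em) * g (i - 1)"
        by (simp add: mult.assoc)
      ultimately show ?thesis by simp
    qed
    finally show ?thesis by (simp add: algebra_simps)
  qed
  \<comment> \<open>The characteristic roots of the recurrence are \<open>b\<close> and \<open>b\<^sup>2\<close>.\<close>
  have closed: "g k = g 0 * ?b ^ k * of_nat (gnum b (Suc k))" if "k \<le> n" for k
    using that
  proof (induction k rule: less_induct)
    case (less k)
    show ?case
    proof (cases k)
      case (Suc i)
      show ?thesis
      proof (cases i)
        case 0
        then show ?thesis using rec[of 0] less.prems Suc gnum_Suc[of b "Suc 0"] by (simp add: algebra_simps)
      next
        case (Suc j)
        have "g (Suc i) = ?b * (?b + 1) * g i - ?b ^ 3 * g j"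
          using rec[of i] less.prems \<open>k = Suc i\<close> Suc by simp
        moreover have "g i = g 0 * ?b ^ i * of_nat (gnum b (Suc i))"
          and "g j = g 0 * ?b ^ j * of_nat (gnum b (Suc j))"
          using less.IH[of i] less.IH[of j] less.prems \<open>k = Suc i\<close> Suc by auto
        ultimately show ?thesis
          using \<open>k = Suc i\<close> Suc gnum_Suc[of b "Suc j"] gnum_Suc[of b "Suc (Suc j)"]
          by (simp add: algebra_simps power3_eq_cube)
      qed
    qed simp
  qed
  have "gnum b (Suc n) > 0" by (simp add: gnum_Suc)
  moreover have "g n = 0" by (simp add: g_def)
  ultimately have "g 0 = 0" using closed[of n] b by (simp del: of_nat_add)
  then have "g k = 0" if "k < n" for k using closed[of k] that by simp
  then have "v = 0\<^sub>v n" using v(1) by (intro eq_vecI) (auto simp: g_def)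
  then show False using v(2) by contradiction
qed

lemma mmul_dual_idem:
  assumes "finite X"
  shows "mmul X (dual_idem X E x j) (mmul X A (dual_idem X E x i)) y z =
    (if y \<in> X \<and> z \<in> X \<and> gdist E x y = enat j \<and> gdist E x z = enat i then A y z else 0)"
proof -
  have 1: "mmul X A (dual_idem X E x i) w z = (if z \<in> X \<and> gdist E x z = enat i then A w z else 0)" for w
  proof -
    have "mmul X A (dual_idem X E x i) w z =
        (\<Sum>u\<in>X. if u = z then (if gdist E x z = enat i then A w z else 0) else 0)"
      unfolding mmul_def dual_idem_def by (rule sum.cong) auto
    then show ?thesis using assms by simp
  qed
  have 2: "mmul X (dual_idem X E x j) M y z = (if y \<in> X \<and> gdist E x y = enat j then M y z else 0)" for M
  proof -
    have "mmul X (dual_idem X E x j) M y z =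
        (\<Sum>w\<in>X. if w = y then (if gdist E x y = enat j then M y z else 0) else 0)"
      unfolding mmul_def dual_idem_def by (rule sum.cong) auto
    then show ?thesis using assms by simp
  qed
  show ?thesis unfolding 2 1 by simp
qed

lemma subconstituent_support:
  assumes "finite X" "v \<in> subconstituent X E x i" "v z \<noteq> 0"
  shows "z \<in> X \<and> gdist E x z = enat i"
proof (rule ccontr)
  assume "\<not> ?thesis"
  moreover obtain v' where "v = mapply X (dual_idem X E x i) v'"
    using assms(2) unfolding subconstituent_def by blast
  ultimately have "v z = 0"
    unfolding mapply_def dual_idem_def by (auto intro!: sum.neutral)
  then show False using assms(3) by contradiction
qed

text \<open>Vectors of the subconstituent are supported at distance \<open>i\<close>, so only the
  columns there matter and the identity can be checked entry by entry.\<close>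

lemma agree_on_subconstituent:
  assumes "finite X"
    and "\<And>y z. z \<in> X \<Longrightarrow> gdist E x z = enat i \<Longrightarrow> M y z = N y z"
  shows "agree_on X (subconstituent X E x i) M N"
  unfolding agree_on_def mapply_def
proof (intro ballI ext sum.cong refl)
  fix v y z assume v: "v \<in> subconstituent X E x i" and "z \<in> X"
  show "M y z * v z = N y z * v z"
    using subconstituent_support[OF assms(1) v, of z] assms(2)[of z y] by (cases "v z = 0") auto
qed

section \<open>Distance from the base vertex and products of covering matrices\<close>

context dual_polar
begin

abbreviation "E \<equiv> dual_polar_edges"

definition level :: "'v set \<Rightarrow> nat" where
  "level y = D - dim (x \<inter> y)"

text \<open>Distances and matrices are computed for any edge set between \<open>cov_edges\<close>
  and \<open>E\<close>, so that the results apply both to the whole graph and to the graph without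
  its flat edges.\<close>

definition cov_edges :: "('v set \<times> 'v set) set" where
  "cov_edges = {(y, z). cov y z \<or> cov z y}"

lemma dim_x_Int_le: "dim (x \<inter> y) \<le> D"
  using dim_subset[of "x \<inter> y" x] vertex_dim[OF x_vertex] by simp

lemma edge_iff: "(y, z) \<in> E \<longleftrightarrow> y \<in> X \<and> z \<in> X \<and> dim (y \<inter> z) = D - 1"
  unfolding dual_polar_edges_def by simp

lemma cov_edges_subset: "cov_edges \<subseteq> E"
  unfolding cov_edges_def by (auto simp: edge_iff cov_iff_adjacent Int_commute)

text \<open>An edge raises the level by at most one: inside a vertex \<open>u\<close> of dimension
  \<open>D\<close>, the hyperplane \<open>u \<inter> y\<close> retains all but at most one dimension
  of \<open>x \<inter> u\<close>.\<close>

lemma path_level: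
  assumes "E' \<subseteq> E" "(x, y) \<in> E' ^^ n"
  shows "y \<in> X \<and> level y \<le> n"
  using assms(2)
proof (induction n arbitrary: y)
  case 0
  then have y: "y = x" by simp
  show ?case unfolding y level_def using x_vertex vertex_dim[OF x_vertex] by simp
next
  case (Suc n)
  then obtain u where u: "(x, u) \<in> E' ^^ n" "(u, y) \<in> E'" by auto
  then have uy: "u \<in> X" "y \<in> X" "dim (u \<inter> y) = D - 1" using assms(1) edge_iff by auto
  have s: "subspace (x \<inter> u)" "subspace (u \<inter> y)" "subspace u"
    using uy subspace_x_Int vertex_subspace subspace_inter by auto
  have "dim ((x \<inter> u) \<boxplus> (u \<inter> y)) \<le> D"
    using ssum_least[OF s(3), of "x \<inter> u" "u \<inter> y"] vertex_dim[OF uy(1)] dim_subset by fastforce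
  moreover have "dim ((x \<inter> u) \<inter> (u \<inter> y)) \<le> dim (x \<inter> y)" by (intro dim_subset) auto
  ultimately have "dim (x \<inter> u) \<le> Suc (dim (x \<inter> y))" using dim_ssum[OF s(1,2)] uy(3) by linarith
  then show ?case using Suc.IH[OF u(1)] uy(2) unfolding level_def by linarith
qed

text \<open>The base vertex lies below every vertex, so at positive level the interval count is a
  positive Gaussian number and some lower cover exists to descend to.\<close>

lemma exists_path:
  assumes "cov_edges \<subseteq> E'" "y \<in> X"
  shows "(x, y) \<in> E' ^^ level y"
  using assms(2)
proof (induction "level y" arbitrary: y)
  case 0
  then have "dim (x \<inter> y) = D" using dim_x_Int_le[of y] by (simp add: level_def)
  then have "x \<inter> y = x"
    using subspace_x_Int[OF 0(2)] x_subspace vertex_dim[OF x_vertex] by (intro eq_if_dim_le) auto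
  then have "x = y" using vertex_eqI[OF x_vertex 0(2)] by blast
  then show ?case using 0 by simp
next
  case (Suc k)
  have "below x y" unfolding below_def using vertex_subspace[OF Suc.prems] ssum_upper2[of y x] by simp
  then have "card {u. cov u y \<and> below x u} = gnum (r\<^sup>2) (Suc k)"
    using card_interval[OF x_vertex Suc.prems] vertex_dim[OF x_vertex] Suc(2) by (simp add: level_def)
  also have "\<dots> \<noteq> 0" by (simp add: gnum_Suc)
  finally have "{u. cov u y \<and> below x u} \<noteq> {}" by (metis card.empty)
  then obtain u where u: "cov u y" by blast
  then have "k = level u" using cov_dest(4)[OF u] Suc(2) by (simp add: level_def)
  then have "(x, u) \<in> E' ^^ k" using Suc.hyps(1) cov_dest(1)[OF u] by metis
  moreover have "(u, y) \<in> E'" using u assms(1) by (auto simp: cov_edges_def)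
  ultimately show ?case using Suc(2) by (metis relcompI relpow.simps(2))
qed

lemma gdist_level:
  assumes E': "cov_edges \<subseteq> E'" "E' \<subseteq> E" and y: "y \<in> X"
  shows "gdist E' x y = enat (level y)"
  unfolding gdist_def
proof (rule antisym)
  show "Inf {enat n |n. (x, y) \<in> E' ^^ n} \<le> enat (level y)"
    using exists_path[OF E'(1) y] by (intro Inf_lower) blast
  show "enat (level y) \<le> Inf {enat n |n. (x, y) \<in> E' ^^ n}"
    using path_level[OF E'(2)] by (intro Inf_greatest) auto
qed

lemma cov_edges_subset_flat: "cov_edges \<subseteq> flat_edges_removed E x"
proof -
  have "gdist E x y \<noteq> gdist E x z" if "cov y z" for y z
    using cov_dest[OF that] gdist_level[OF cov_edges_subset order_refl] dim_x_Int_le[of y]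
    by (simp add: level_def)
  then have "gdist E x y \<noteq> gdist E x z" if "(y, z) \<in> cov_edges" for y z
    using that unfolding cov_edges_def by fastforce
  then show ?thesis using cov_edges_subset unfolding flat_edges_removed_def by blast
qed

lemma flat_subset: "flat_edges_removed E x \<subseteq> E"
  unfolding flat_edges_removed_def by blast

definition cov_mat :: "'v set cmat" where
  "cov_mat y z = (if cov y z then 1 else 0)"

lemma cov_iff_edge_level:
  assumes "cov_edges \<subseteq> E'" "E' \<subseteq> E"
  shows "cov y z \<longleftrightarrow> y \<in> X \<and> z \<in> X \<and> ((y, z) \<in> E' \<or> (z, y) \<in> E') \<and> level z = Suc (level y)"
proof
  assume c: "cov y z"
  then show "y \<in> X \<and> z \<in> X \<and> ((y, z) \<in> E' \<or> (z, y) \<in> E') \<and> level z = Suc (level y)"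
    using assms(1) cov_dest[OF c] dim_x_Int_le[of y] by (auto simp: cov_edges_def level_def)
next
  assume "y \<in> X \<and> z \<in> X \<and> ((y, z) \<in> E' \<or> (z, y) \<in> E') \<and> level z = Suc (level y)"
  then show "cov y z"
    using assms(2) dim_x_Int_le[of y] dim_x_Int_le[of z]
    by (auto simp: cov_iff_adjacent level_def edge_iff Int_commute)
qed

lemma lowering_eq:
  assumes E': "cov_edges \<subseteq> E'" "E' \<subseteq> E"
  shows "lowering D X E' x = cov_mat"
proof (intro ext)
  fix y z
  have "lowering D X E' x y z = (\<Sum>i=1..D. if i = level z then
      (if y \<in> X \<and> z \<in> X \<and> level z = Suc (level y) then adj_mat E' y z else 0) else 0)"
    unfolding lowering_def mmul_dual_idem[OF finite_vector_sets]
    by (rule sum.cong) (auto simp: gdist_level[OF E'])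
  also have "\<dots> = cov_mat y z"
    using cov_iff_edge_level[OF E', of y z] E'(1)
    by (auto simp: cov_mat_def adj_mat_def cov_edges_def level_def)
  finally show "lowering D X E' x y z = cov_mat y z" .
qed

lemma raising_eq:
  assumes E': "cov_edges \<subseteq> E'" "E' \<subseteq> E"
  shows "raising D X E' x = (\<lambda>y z. cov_mat z y)"
proof (intro ext)
  fix y z
  have "raising D X E' x y z = (\<Sum>i<D. if i = level z then
      (if y \<in> X \<and> z \<in> X \<and> level y = Suc (level z) then adj_mat E' y z else 0) else 0)"
    unfolding raising_def mmul_dual_idem[OF finite_vector_sets]
    by (rule sum.cong) (auto simp: gdist_level[OF E'])
  also have "\<dots> = cov_mat z y"
    using cov_iff_edge_level[OF E', of z y] E'(1)
    by (auto simp: cov_mat_def adj_mat_def cov_edges_def level_def)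
  finally show "raising D X E' x y z = cov_mat z y" .
qed

lemma sum_X_indicator: "(\<Sum>w\<in>X. if P w then 1 else 0 :: complex) = of_nat (card {w \<in> X. P w})"
  by (simp add: sum.If_cases Int_def)

lemma sum_if_const: "(\<Sum>t\<in>S. if P then f t else 0) = (if P then \<Sum>t\<in>S. f t else 0)"
  by simp

lemma mmul_cov_cov:
  "mmul X cov_mat cov_mat y z =
    (if y \<in> X \<and> z \<in> X \<and> below y z \<and> dim (x \<inter> y) = dim (x \<inter> z) + 2 then of_nat (r\<^sup>2 + 1) else 0)"
proof -
  have "mmul X cov_mat cov_mat y z = (\<Sum>w\<in>X. if cov y w \<and> cov w z then 1 else 0)"
    unfolding mmul_def cov_mat_def by (rule sum.cong) auto
  also have "\<dots> = of_nat (card {w. cov y w \<and> cov w z})"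
    unfolding sum_X_indicator by (rule arg_cong[where f = "\<lambda>S. of_nat (card S)"]) (auto simp: cov_def)
  finally have eq: "mmul X cov_mat cov_mat y z = of_nat (card {w. cov y w \<and> cov w z})" .
  show ?thesis
  proof (cases "y \<in> X \<and> z \<in> X")
    case True
    then show ?thesis using eq card_cov_cov[of y z] by simp
  next
    case False
    then have empty: "{w. cov y w \<and> cov w z} = {}" using cov_dest by blast
    show ?thesis unfolding eq empty using False by auto
  qed
qed

text \<open>Regrouping makes the inner product a known count: \<open>L L R\<close> is read as
  \<open>(L L) R\<close> and \<open>L R L\<close> as \<open>(L R) L\<close>.\<close>

lemma mmul_assoc: "mmul X (mmul X M N) P = mmul X M (mmul X N P)"
proof (intro ext)
  fix y z
  have "mmul X (mmul X M N) P y z = (\<Sum>w\<in>X. \<Sum>u\<in>X. M y u * N u w * P w z)"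
    by (simp add: mmul_def sum_distrib_right)
  also have "\<dots> = (\<Sum>u\<in>X. \<Sum>w\<in>X. M y u * N u w * P w z)" by (rule sum.swap)
  also have "\<dots> = mmul X M (mmul X N P) y z" by (simp add: mmul_def sum_distrib_left mult.assoc)
  finally show "mmul X (mmul X M N) P y z = mmul X M (mmul X N P) y z" .
qed

lemma mmul_RLL:
  "mmul X (\<lambda>y z. cov_mat z y) (mmul X cov_mat cov_mat) y z =
    (if y \<in> X \<and> z \<in> X \<and> dim (x \<inter> y) = Suc (dim (x \<inter> z))
     then of_nat (r\<^sup>2 + 1) * of_nat (card {t. cov t y \<and> below t z}) else 0)"
proof -
  have "mmul X (\<lambda>y z. cov_mat z y) (mmul X cov_mat cov_mat) y z =
      (\<Sum>t\<in>X. if y \<in> X \<and> z \<in> X \<and> dim (x \<inter> y) = Suc (dim (x \<inter> z))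
        then of_nat (r\<^sup>2 + 1) * (if cov t y \<and> below t z then 1 else 0) else 0)"
    unfolding mmul_def[of X "\<lambda>y z. cov_mat z y"] mmul_cov_cov
    by (rule sum.cong) (auto simp: cov_mat_def cov_def)
  also have "\<dots> = (if y \<in> X \<and> z \<in> X \<and> dim (x \<inter> y) = Suc (dim (x \<inter> z))
     then of_nat (r\<^sup>2 + 1) * of_nat (card {t \<in> X. cov t y \<and> below t z}) else 0)"
    unfolding sum_if_const sum_distrib_left[symmetric] sum_X_indicator ..
  also have "{t \<in> X. cov t y \<and> below t z} = {t. cov t y \<and> below t z}" by (auto simp: cov_def)
  finally show ?thesis .
qed

lemma mmul_LLR:
  "mmul X cov_mat (mmul X cov_mat (\<lambda>y z. cov_mat z y)) y z =
    (if y \<in> X \<and> z \<in> X \<and> dim (x \<inter> y) = Suc (dim (x \<inter> z))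
     then of_nat (r\<^sup>2 + 1) * of_nat (card {w. cov z w \<and> below y w}) else 0)"
proof -
  have "mmul X cov_mat (mmul X cov_mat (\<lambda>y z. cov_mat z y)) y z =
      (\<Sum>w\<in>X. if y \<in> X \<and> z \<in> X \<and> dim (x \<inter> y) = Suc (dim (x \<inter> z))
        then of_nat (r\<^sup>2 + 1) * (if cov z w \<and> below y w then 1 else 0) else 0)"
    unfolding mmul_assoc[symmetric] unfolding mmul_def[of X "mmul X cov_mat cov_mat"] mmul_cov_cov
    by (rule sum.cong) (auto simp: cov_mat_def cov_def)
  also have "\<dots> = (if y \<in> X \<and> z \<in> X \<and> dim (x \<inter> y) = Suc (dim (x \<inter> z))
     then of_nat (r\<^sup>2 + 1) * of_nat (card {w \<in> X. cov z w \<and> below y w}) else 0)"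
    unfolding sum_if_const sum_distrib_left[symmetric] sum_X_indicator ..
  also have "{w \<in> X. cov z w \<and> below y w} = {w. cov z w \<and> below y w}" by (auto simp: cov_def)
  finally show ?thesis .
qed

lemma mmul_LRL:
  "mmul X cov_mat (mmul X (\<lambda>y z. cov_mat z y) cov_mat) y z =
    (if y \<in> X \<and> z \<in> X \<and> dim (x \<inter> y) = Suc (dim (x \<inter> z))
     then of_nat (\<Sum>u | cov u z. card {w. cov u w \<and> cov y w}) else 0)"
proof -
  have inner: "mmul X cov_mat (\<lambda>y z. cov_mat z y) y u = of_nat (card {w. cov u w \<and> cov y w})" for u
  proof -
    have "mmul X cov_mat (\<lambda>y z. cov_mat z y) y u = (\<Sum>w\<in>X. if cov u w \<and> cov y w then 1 else 0)"
      unfolding mmul_def cov_mat_def by (rule sum.cong) auto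
    also have "\<dots> = of_nat (card {w. cov u w \<and> cov y w})"
      unfolding sum_X_indicator by (rule arg_cong[where f = "\<lambda>S. of_nat (card S)"]) (auto simp: cov_def)
    finally show ?thesis .
  qed
  have "mmul X cov_mat (mmul X (\<lambda>y z. cov_mat z y) cov_mat) y z =
      (\<Sum>u\<in>X. if cov u z then of_nat (card {w. cov u w \<and> cov y w}) else 0)"
    unfolding mmul_assoc[symmetric]
    unfolding mmul_def[of X "mmul X cov_mat (\<lambda>y z. cov_mat z y)"] inner
    by (rule sum.cong) (auto simp: cov_mat_def)
  also have "\<dots> = (\<Sum>u | cov u z. of_nat (card {w. cov u w \<and> cov y w}))"
    by (intro sum.mono_neutral_cong_right) (auto simp: cov_def)
  finally have eq: "mmul X cov_mat (mmul X (\<lambda>y z. cov_mat z y) cov_mat) y z =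
      (\<Sum>u | cov u z. of_nat (card {w. cov u w \<and> cov y w}))" .
  show ?thesis
  proof (cases "y \<in> X \<and> z \<in> X \<and> dim (x \<inter> y) = Suc (dim (x \<inter> z))")
    case True
    then show ?thesis using eq by simp
  next
    case False
    have "{w. cov u w \<and> cov y w} = {}" if "cov u z" for u
      using False cov_dest[OF that] cov_dest(1,4) by fastforce
    then have "(\<Sum>u | cov u z. of_nat (card {w. cov u w \<and> cov y w})) = (0 :: complex)"
      by (intro sum.neutral) auto
    then show ?thesis using eq False by simp
  qed
qed

section \<open>The cubic matrix identity and the parameter matrix\<close>

lemma matrix_identity:
  fixes b :: complex
  assumes b: "b = of_nat (r\<^sup>2)"
  defines "R \<equiv> \<lambda>y z. cov_mat z y"
  shows "- (b\<^sup>2 / (b + 1)) * mmul X R (mmul X cov_mat cov_mat) y z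
      + mmul X cov_mat (mmul X R cov_mat) y z
      - (1 / (b * (b + 1))) * mmul X cov_mat (mmul X cov_mat R) y z
    = of_nat r ^ (2 * D - 1) * cov_mat y z"
proof (cases "y \<in> X \<and> z \<in> X \<and> dim (x \<inter> y) = Suc (dim (x \<inter> z))")
  case True
  define n1 n2 n3 where "n1 = (of_nat (card {t. cov t y \<and> below t z}) :: complex)"
    and "n2 = (of_nat (\<Sum>u | cov u z. card {w. cov u w \<and> cov y w}) :: complex)"
    and "n3 = (of_nat (card {w. cov z w \<and> below y w}) :: complex)"
  define p where "p = (of_nat r ^ (2 * D - 1) * cov_mat y z :: complex)"
  have b1: "b + 1 = of_nat (r\<^sup>2 + 1)" unfolding b by simp
  have "b + 1 \<noteq> 0" unfolding b1 of_nat_eq_0_iff by simp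
  moreover have "b \<noteq> 0" using r_gt_1 by (simp add: b)
  ultimately have b0: "b \<noteq> 0" "b + 1 \<noteq> 0" by auto
  have "of_nat (r\<^sup>2 * (\<Sum>u | cov u z. card {w. cov u w \<and> cov y w})) =
      (of_nat ((r\<^sup>2) ^ 3 * card {t. cov t y \<and> below t z} + card {w. cov z w \<and> below y w} +
      (if cov y z then r * (r\<^sup>2) ^ D else 0)) :: complex)"
    using counting_identity[of y z] True by simp
  \<comment> \<open>This is the origin of the constant: dividing the counting identity by b leaves
    \<open>r ^ (2 * D - 1)\<close>. The truncated exponent is exact because \<open>D\<close> is
    positive.\<close>
  moreover have "r * (r\<^sup>2) ^ D = r\<^sup>2 * r ^ (2 * D - 1)"
  proof -
    have "2 + (2 * D - 1) = Suc (2 * D)" using D_pos by simp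
    then show ?thesis unfolding power_add[symmetric] power_mult[symmetric] by simp
  qed
  ultimately have count: "b * n2 = b ^ 3 * n1 + n3 + b * p"
    by (auto simp: b n1_def n2_def n3_def p_def cov_mat_def)
  \<comment> \<open>The factor b + 1 from the middle vertices of the two double steps cancels the
    denominators.\<close>
  have "- (b\<^sup>2 / (b + 1)) * ((b + 1) * n1) + n2 - (1 / (b * (b + 1))) * ((b + 1) * n3) =
      (b * n2 - b ^ 3 * n1 - n3) / b"
  proof -
    have "- (b\<^sup>2 / (b + 1)) * ((b + 1) * n1) = - (b\<^sup>2 * n1)" using b0 by simp
    moreover have "(1 / (b * (b + 1))) * ((b + 1) * n3) = n3 / b" using b0 by simp
    ultimately show ?thesis
      using b0(1) by (simp only:) (simp add: diff_divide_distrib power2_eq_square power3_eq_cube)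
  qed
  also have "\<dots> = p" using b0 unfolding count by simp
  finally show ?thesis
    unfolding R_def mmul_RLL mmul_LRL mmul_LLR b1[symmetric] n1_def[symmetric] n2_def[symmetric]
      n3_def[symmetric] p_def using True by simp
next
  case False
  then have "\<not> cov y z" using cov_dest by blast
  then have "cov_mat y z = 0" by (simp add: cov_mat_def)
  then show ?thesis unfolding R_def mmul_RLL mmul_LRL mmul_LLR if_not_P[OF False] by simp
qed

text \<open>At the first level \<open>e_minus\<close> has its default value 0 instead of the
  constant coefficient. Both give the same, since a path cannot go down twice from level one;
  \<open>LLR_level_D\<close> does the same for \<open>e_plus\<close> at the last level.\<close>

lemma RLL_level_one:
  assumes "level z = 1"
  shows "mmul X (\<lambda>y z. cov_mat z y) (mmul X cov_mat cov_mat) y z = 0"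
proof -
  have False if "cov t y" "dim (x \<inter> y) = Suc (dim (x \<inter> z))" for t
    using cov_dest(4)[OF that(1)] that(2) dim_x_Int_le[of t] assms by (simp add: level_def)
  then have "{t. cov t y \<and> below t z} = {}" if "dim (x \<inter> y) = Suc (dim (x \<inter> z))"
    using that by blast
  then show ?thesis unfolding mmul_RLL by simp
qed

lemma LLR_level_D:
  assumes "level z = D"
  shows "mmul X cov_mat (mmul X cov_mat (\<lambda>y z. cov_mat z y)) y z = 0"
proof -
  have False if "cov z w" for w
    using cov_dest(4)[OF that] dim_x_Int_le[of z] assms D_pos by (simp add: level_def)
  then have "{w. cov z w \<and> below y w} = {}" by blast
  then show ?thesis unfolding mmul_LLR by simp
qed

text \<open>The coefficients are prescribed only away from the boundary levels, so one lemma yields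
  both the identity with constant coefficients and the one with the defaults of
  \<open>e_minus\<close> and \<open>e_plus\<close>.\<close>

lemma agree_on_level:
  assumes E': "cov_edges \<subseteq> E'" "E' \<subseteq> E"
    and b: "b = of_nat (r\<^sup>2)"
    and em: "i \<noteq> 1 \<Longrightarrow> em = - (b\<^sup>2 / (b + 1))"
    and ep: "i \<noteq> D \<Longrightarrow> ep = - (1 / (b * (b + 1)))"
  defines "L \<equiv> lowering D X E' x" and "R \<equiv> raising D X E' x"
  shows "agree_on X (subconstituent X E' x i)
    (\<lambda>y z. em * mmul X R (mmul X L L) y z + mmul X L (mmul X R L) y z + ep * mmul X L (mmul X L R) y z)
    (\<lambda>y z. of_nat r ^ (2 * D - 1) * L y z)"
proof (rule agree_on_subconstituent[OF finite_vector_sets])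
  fix y z assume "z \<in> X" "gdist E' x z = enat i"
  then have i: "level z = i" using gdist_level[OF E'] by simp
  have LR: "L = cov_mat" "R = (\<lambda>y z. cov_mat z y)"
    unfolding L_def R_def using lowering_eq[OF E'] raising_eq[OF E'] by auto
  have "em * mmul X R (mmul X L L) y z = - (b\<^sup>2 / (b + 1)) * mmul X R (mmul X L L) y z"
    using em RLL_level_one[of z y] i unfolding LR by (cases "i = 1") auto
  moreover have "ep * mmul X L (mmul X L R) y z = - (1 / (b * (b + 1))) * mmul X L (mmul X L R) y z"
    using ep LLR_level_D[of z y] i unfolding LR by (cases "i = D") auto
  ultimately show "em * mmul X R (mmul X L L) y z + mmul X L (mmul X R L) y z
      + ep * mmul X L (mmul X L R) y z = of_nat r ^ (2 * D - 1) * L y z"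
    using matrix_identity[OF b, of y z] unfolding LR by simp
qed

text \<open>The entries depend only on the offset from the diagonal. Every principal submatrix on
  consecutive indices is thus a smaller copy of the same matrix, and
  \<open>det_tridiagonal_nonzero\<close> covers all of them.\<close>

definition toeplitz :: "nat \<Rightarrow> nat \<Rightarrow> complex" where
  "toeplitz i j =
    (if i = j then 1
     else if i = Suc j then - ((of_nat (r\<^sup>2))\<^sup>2 / (of_nat (r\<^sup>2) + 1))
     else if j = Suc i then - (1 / (of_nat (r\<^sup>2) * (of_nat (r\<^sup>2) + 1)))
     else 0)"

lemma toeplitz_nonzero: "toeplitz (Suc i) i \<noteq> 0" "toeplitz i (Suc i) \<noteq> 0"
proof -
  have "of_nat (r\<^sup>2) + 1 = (of_nat (r\<^sup>2 + 1) :: complex)" by simp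
  also have "\<dots> \<noteq> 0" unfolding of_nat_eq_0_iff by simp
  finally have "of_nat (r\<^sup>2) + 1 \<noteq> (0 :: complex)" .
  then show "toeplitz (Suc i) i \<noteq> 0" "toeplitz i (Suc i) \<noteq> 0"
    using r_gt_1 by (auto simp: toeplitz_def)
qed

lemma parameter_matrix_toeplitz: "parameter_matrix D toeplitz"
proof -
  have "det (mat (t - s + 1) (t - s + 1) (\<lambda>(i, j). toeplitz (s + i) (s + j))) \<noteq> 0" for s t
  proof -
    have "mat (t - s + 1) (t - s + 1) (\<lambda>(i, j). toeplitz (s + i) (s + j)) =
        mat (t - s + 1) (t - s + 1) (\<lambda>(i, j). if i = j then 1
          else if i = Suc j then - ((of_nat (r\<^sup>2))\<^sup>2 / (of_nat (r\<^sup>2) + 1))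
          else if j = Suc i then - (1 / (of_nat (r\<^sup>2) * (of_nat (r\<^sup>2) + 1))) else 0)"
      unfolding toeplitz_def by (intro cong_mat) auto
    then show ?thesis using det_tridiagonal_nonzero[of "r\<^sup>2" "t - s + 1"] r_gt_1 by simp
  qed
  moreover have "toeplitz i (i - 1) \<noteq> 0" if "i \<in> {2..D}" for i
    using toeplitz_nonzero(1)[of "i - 1"] that by (cases i) auto
  moreover have "toeplitz i j = 0" if "i + 1 < j \<or> j + 1 < i" for i j
    using that by (auto simp: toeplitz_def)
  moreover have "toeplitz i i = 1" for i by (simp add: toeplitz_def)
  ultimately show ?thesis unfolding parameter_matrix_def by blast
qed

lemma strongly_uniform:
  "strongly_uniform_structure D X (flat_edges_removed E x) x toeplitz (\<lambda>_. of_nat r ^ (2 * D - 1))"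
proof -
  have em: "e_minus toeplitz i = - ((of_nat (r\<^sup>2))\<^sup>2 / (of_nat (r\<^sup>2) + 1))" if "i \<in> {1..D}" "i \<noteq> 1" for i
    using that by (cases i) (auto simp: e_minus_def toeplitz_def)
  have ep: "e_plus D toeplitz i = - (1 / (of_nat (r\<^sup>2) * (of_nat (r\<^sup>2) + 1)))" if "i \<noteq> D" for i
    using that by (auto simp: e_plus_def toeplitz_def)
  have "uniform_structure D X (flat_edges_removed E x) x toeplitz (\<lambda>_. of_nat r ^ (2 * D - 1))"
    unfolding uniform_structure_def Let_def
    using parameter_matrix_toeplitz agree_on_level[OF cov_edges_subset_flat flat_subset refl em ep] by blast
  moreover have "e_minus toeplitz i \<noteq> 0" if "i \<in> {2..D}" for i
    using that toeplitz_nonzero(1)[of "i - 1"] by (cases i) (auto simp: e_minus_def)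
  moreover have "e_plus D toeplitz i \<noteq> 0" if "i \<in> {1..D - 1}" for i
    using that toeplitz_nonzero(2)[of i] by (auto simp: e_plus_def)
  ultimately show ?thesis unfolding strongly_uniform_structure_def by blast
qed

end

theorem theorem8p4:
  fixes q :: int and D :: nat
    and scale :: "'k::{field,finite} \<Rightarrow> 'v::ab_group_add \<Rightarrow> 'v"
    and h :: "'v \<Rightarrow> 'v \<Rightarrow> 'k"
    and x :: "'v set"
  assumes "q < -1" and "primepow (nat (- q))" and "D \<ge> 3"
    and "hermitian_space scale (nat (- q)) D h"
    and "x \<in> hermitian_space.dual_polar_vertices scale D h"
  shows
    "let X = hermitian_space.dual_polar_vertices scale D h;
         E = hermitian_space.dual_polar_edges scale D h;
         L = lowering D X E x;
         R = raising D X E x;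
         c = (of_int q :: complex)
     in
       (\<forall>i\<in>{1..D}. agree_on X (subconstituent X E x i)
          (\<lambda>y z. - (c ^ 4 / (c ^ 2 + 1)) * mmul X R (mmul X L L) y z
                 + mmul X L (mmul X R L) y z
                 - (c powi (-2) / (c ^ 2 + 1)) * mmul X L (mmul X L R) y z)
          (\<lambda>y z. (- c) ^ (2 * D - 1) * L y z)) \<and>
       supports_strongly_uniform D X E x \<and>
       (\<exists>U f. strongly_uniform_structure D X (flat_edges_removed E x) x U f \<and>
          (\<forall>i\<in>{2..D}. e_minus U i = - (c ^ 4 / (c ^ 2 + 1))) \<and>
          (\<forall>i\<in>{1..D - 1}. e_plus D U i = - (c powi (-2) / (c ^ 2 + 1))) \<and>
          (\<forall>i\<in>{1..D}. f i = (- c) ^ (2 * D - 1)))"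
proof -
  define r where "r = nat (- q)"
  interpret hermitian_space scale r D h using assms(4) by (simp add: r_def)
  interpret dual_polar scale r D h x
    using assms(3,5) by unfold_locales auto
  define c :: complex where "c = of_int q"
  define b :: complex where "b = of_nat (r\<^sup>2)"
  \<comment> \<open>As \<open>q\<close> is negative, \<open>r\<close> is \<open>- c\<close> and b is
    the square of \<open>c\<close>. The coefficients involve only even powers of \<open>c\<close>,
    and the right-hand side is a power of \<open>r\<close>.\<close>
  have rc: "of_nat r = - c" using assms(1) by (simp add: r_def c_def)
  then have bc: "b = c\<^sup>2" by (simp add: b_def)
  have em: "c ^ 4 / (c\<^sup>2 + 1) = b\<^sup>2 / (b + 1)" by (simp add: bc flip: power_mult)
  have ep: "c powi (-2) / (c\<^sup>2 + 1) = 1 / (b * (b + 1))"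
    by (simp add: bc power_int_minus divide_simps)
  have first: "agree_on X (subconstituent X E x i)
      (\<lambda>y z. - (c ^ 4 / (c ^ 2 + 1)) * mmul X (raising D X E x) (mmul X (lowering D X E x) (lowering D X E x)) y z
             + mmul X (lowering D X E x) (mmul X (raising D X E x) (lowering D X E x)) y z
             - (c powi (-2) / (c ^ 2 + 1)) * mmul X (lowering D X E x) (mmul X (lowering D X E x) (raising D X E x)) y z)
      (\<lambda>y z. (- c) ^ (2 * D - 1) * lowering D X E x y z)" for i
    using agree_on_level[OF cov_edges_subset order_refl b_def refl refl, of i]
    unfolding em ep rc by simp
  have second: "e_minus toeplitz i = - (c ^ 4 / (c ^ 2 + 1))" if "i \<in> {2..D}" for i
    using that unfolding em by (cases i) (auto simp: e_minus_def toeplitz_def b_def)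
  have third: "e_plus D toeplitz i = - (c powi (-2) / (c ^ 2 + 1))" if "i \<in> {1..D - 1}" for i
    using that unfolding ep by (auto simp: e_plus_def toeplitz_def b_def)
  have su: "strongly_uniform_structure D X (flat_edges_removed E x) x toeplitz (\<lambda>_. (- c) ^ (2 * D - 1))"
    using strongly_uniform unfolding rc .
  show ?thesis
    unfolding Let_def c_def[symmetric] supports_strongly_uniform_def
    using first second third su by blast
qed

end
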